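(* Let $\mathbb{F}$ be a field, let $\mathcal{E}=(D,E,i,j,k)$ be an exact couple of order $a\in\mathbb{Z}$ of bigraded $\mathbb{F}$-vector spaces, of finite total dimension, and let $\{E^{(r)}\}_{r\ge 0}$ be the spectral sequence induced from $\mathcal{E}$, with associated chain complex $C_\bullet(E)$ (all defined in the context). If the spectral sequence converges to a collection of vector spaces $H_*=(H_\ell)_{\ell\in\mathbb{Z}}$, then the homology of $C_\bullet(E)$ is isomorphic to $H_*$, i.e. $H_\ell(C_\bullet(E))\cong H_\ell$ for all $\ell\in\mathbb{Z}$.
   Context: An exact couple of order $a$ consists of bigraded vector spaces $D=\bigoplus_{p,q\in\mathbb{Z}}D_{p,q}$, $E=\bigoplus_{p,q\in\mathbb{Z}}E_{p,q}$ and bigraded linear maps $i:D\to D$, $j:D\to E$, $k:E\to D$ of bidegrees $(1,-1)$, $(-a,a)$, $(-1,0)$ with $\ker i=\operatorname{im}k$, $\ker j=\operatorname{im}i$, $\ker k=\operatorname{im}j$. An exact couple (or a spectral sequence) is of finite total dimension if all its vector spaces are finite dimensional and only finitely many of them are nonzero; for an exact couple this concerns all the $D_{p,q}$ and all the $E_{p,q}$. For $r\ge0$ (with $i^0=\mathrm{id}_D$), $B^{(r)}:=j(\ker(i^r))$ and $Z^{(r)}:=k^{-1}(\operatorname{im}(i^r))$; these are bigraded subspaces of $E$ with $0=B^{(0)}\subseteq B^{(1)}\subseteq\cdots\subseteq Z^{(1)}\subseteq Z^{(0)}=E$. The associated spectral sequence has pages $E^{(r)}:=Z^{(r)}/B^{(r)}$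 with differential $d^{(r)}([\alpha])=[j(x)]$ where $k(\alpha)=i^r(x)$, of bidegree $(-(a+r)-1,a+r)$; the homology of $(E^{(r)},d^{(r)})$ is isomorphic to $E^{(r+1)}$. $E^\infty_{p,q}$ denotes the stable value of $E^{(r)}_{p,q}$ for large $r$. The spectral sequence converges to $H_*$ if for each $\ell$ there is a finite filtration $0=H^s_\ell\subseteq\cdots\subseteq H^{p-1}_\ell\subseteq H^p_\ell\subseteq\cdots\subseteq H^t_\ell=H_\ell$ and isomorphisms $E^\infty_{p,q}\cong H^p_\ell/H^{p-1}_\ell$ whenever $p+q=\ell$. Let $\overline d^{(r)}:Z^{(r)}/Z^{(r+1)}\to B^{(r+1)}/B^{(r)}$ be the isomorphism induced by $d^{(r)}$, $\overline d^{(r)}([\alpha])=[j(x)]$ for any $x$ with $k(\alpha)=i^r(x)$. Let $N$ be such that $B^{(r)}=B^{(r+1)}$ and $Z^{(r)}=Z^{(r+1)}$ for all $r\ge N$ (such $N$ exists by finite total dimension). The chain complex $C_\bullet(E)$ is $$C_\ell=\bigoplus_{p+q=\ell}\Big(\bigoplus_{r=0}^{N-1}B^{(r+1)}_{p,q}/B^{(r)}_{p,q}\ \oplus\ Z^{(N)}_{p,q}/B^{(N)}_{p,q}\ \oplus\ \bigoplus_{r=0}^{N-1}Z^{(r)}_{p,q}/Z^{(r+1)}_{p,q}\Big),$$ with differential equal to $\overline d^{(r)}$ from the summand $Z^{(r)}/Z^{(r+1)}$ to the summand $B^{(r+1)}/B^{(r)}$ and zero on all other summands (it lowers total degree by one).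 *)

theory Defs
  imports "HOL-Algebra.AbelCoset" "Jordan_Normal_Form.Missing_VectorSpace"
begin

section \<open>Vector spaces: isomorphism, quotients, direct sums\<close>

definition vs_iso :: "'k ring \<Rightarrow> ('k, 'v) module \<Rightarrow> ('k, 'w) module \<Rightarrow> bool" where
  "vs_iso K V W \<longleftrightarrow> (\<exists>T. linear_map K V W T \<and> bij_betw T (carrier V) (carrier W))"

definition ker_of :: "('k, 'v) module \<Rightarrow> ('k, 'w) module \<Rightarrow> ('v \<Rightarrow> 'w) \<Rightarrow> 'v set" where
  "ker_of V W f = {v \<in> carrier V. f v = \<zero>\<^bsub>W\<^esub>}"

text \<open>The record fields \<^term>\<open>mult\<close> and \<^term>\<open>one\<close>, inherited by modules from rings, play no role
  for vector spaces and get dummy values, here and in the direct sum below.\<close>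

definition quot_space :: "('k, 'v) module \<Rightarrow> 'v set \<Rightarrow> ('k, 'v set) module" where
  "quot_space V W =
     \<lparr>carrier = a_rcosets\<^bsub>V\<^esub> W, mult = (\<lambda>_ _. W), one = W, zero = W, add = set_add V,
      smult = (\<lambda>c A. \<Union>v\<in>A. W +>\<^bsub>V\<^esub> (c \<odot>\<^bsub>V\<^esub> v))\<rparr>"

text \<open>The quotient \<open>Z / B\<close> for subspaces \<open>B \<subseteq> Z \<subseteq> V\<close>.\<close>

definition subquot :: "('k, 'v) module \<Rightarrow> 'v set \<Rightarrow> 'v set \<Rightarrow> ('k, 'v set) module" where
  "subquot V Z B = quot_space (V\<lparr>carrier := Z\<rparr>) B"

definition dsum :: "'i set \<Rightarrow> ('i \<Rightarrow> ('k, 'v) module) \<Rightarrow> ('k, 'i \<Rightarrow> 'v) module" where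
  "dsum I M =
     \<lparr>carrier = {f \<in> \<Pi>\<^sub>E i\<in>I. carrier (M i). finite {i \<in> I. f i \<noteq> \<zero>\<^bsub>M i\<^esub>}},
      mult = (\<lambda>_ _. \<lambda>i\<in>I. \<zero>\<^bsub>M i\<^esub>), one = (\<lambda>i\<in>I. \<zero>\<^bsub>M i\<^esub>), zero = (\<lambda>i\<in>I. \<zero>\<^bsub>M i\<^esub>),
      add = (\<lambda>f g. \<lambda>i\<in>I. f i \<oplus>\<^bsub>M i\<^esub> g i),
      smult = (\<lambda>c f. \<lambda>i\<in>I. c \<odot>\<^bsub>M i\<^esub> f i)\<rparr>"

text \<open>Homology in degree \<open>l\<close> of a complex with \<open>d l : C l \<rightarrow> C (l - 1)\<close>.\<close>

definition homology_space ::
    "(int \<Rightarrow> ('k, 'v) module) \<Rightarrow> (int \<Rightarrow> 'v \<Rightarrow> 'v) \<Rightarrow> int \<Rightarrow> ('k, 'v set) module" where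
  "homology_space C d l =
     subquot (C l) (ker_of (C l) (C (l - 1)) (d l)) (d (l + 1) ` carrier (C (l + 1)))"


section \<open>Exact couples\<close>

text \<open>Bigraded spaces and maps are given by their components: \<open>Dsp X p q\<close> is \<open>D\<^bsub>p,q\<^esub>\<close>, and
  \<open>imap X p q\<close>, \<open>jmap X p q\<close>, \<open>kmap X p q\<close> are the restrictions of \<open>i\<close>, \<open>j\<close>, \<open>k\<close> to the
  component of bidegree \<open>(p, q)\<close> of their domain.\<close>

record ('k, 'd, 'e) couple =
  Dsp :: "int \<Rightarrow> int \<Rightarrow> ('k, 'd) module"
  Esp :: "int \<Rightarrow> int \<Rightarrow> ('k, 'e) module"
  imap :: "int \<Rightarrow> int \<Rightarrow> 'd \<Rightarrow> 'd"
  jmap :: "int \<Rightarrow> int \<Rightarrow> 'd \<Rightarrow> 'e"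
  kmap :: "int \<Rightarrow> int \<Rightarrow> 'e \<Rightarrow> 'd"

locale exact_couple =
  fixes K :: "'k ring" and a :: int and X :: "('k, 'd, 'e) couple"
  assumes D_vectorspace: "\<And>p q. vectorspace K (Dsp X p q)"
    and E_vectorspace: "\<And>p q. vectorspace K (Esp X p q)"
    and i_linear: "\<And>p q. linear_map K (Dsp X p q) (Dsp X (p + 1) (q - 1)) (imap X p q)"
    and j_linear: "\<And>p q. linear_map K (Dsp X p q) (Esp X (p - a) (q + a)) (jmap X p q)"
    and k_linear: "\<And>p q. linear_map K (Esp X p q) (Dsp X (p - 1) q) (kmap X p q)"
    and exact_ki: "\<And>p q. ker_of (Dsp X (p - 1) q) (Dsp X p (q - 1)) (imap X (p - 1) q)
                     = kmap X p q ` carrier (Esp X p q)"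
    and exact_ij: "\<And>p q. ker_of (Dsp X (p + 1) (q - 1)) (Esp X (p + 1 - a) (q - 1 + a))
                       (jmap X (p + 1) (q - 1))
                     = imap X p q ` carrier (Dsp X p q)"
    and exact_jk: "\<And>p q. ker_of (Esp X (p - a) (q + a)) (Dsp X (p - a - 1) (q + a))
                       (kmap X (p - a) (q + a))
                     = jmap X p q ` carrier (Dsp X p q)"

definition finite_total_dim :: "'k ring \<Rightarrow> ('k, 'd, 'e) couple \<Rightarrow> bool" where
  "finite_total_dim K X \<longleftrightarrow>
     (\<forall>p q. vectorspace.fin_dim K (Dsp X p q) \<and> vectorspace.fin_dim K (Esp X p q)) \<and>
     finite {(p, q). carrier (Dsp X p q) \<noteq> {\<zero>\<^bsub>Dsp X p q\<^esub>}} \<and>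
     finite {(p, q). carrier (Esp X p q) \<noteq> {\<zero>\<^bsub>Esp X p q\<^esub>}}"


section \<open>The associated spectral sequence\<close>

text \<open>\<open>i\<^sup>r : D\<^bsub>p,q\<^esub> \<rightarrow> D\<^bsub>p+r,q-r\<^esub>\<close>\<close>

primrec ipow :: "('k, 'd, 'e) couple \<Rightarrow> nat \<Rightarrow> int \<Rightarrow> int \<Rightarrow> 'd \<Rightarrow> 'd" where
  "ipow X 0 p q x = x"
| "ipow X (Suc r) p q x = imap X (p + int r) (q - int r) (ipow X r p q x)"

definition Bsub :: "int \<Rightarrow> ('k, 'd, 'e) couple \<Rightarrow> nat \<Rightarrow> int \<Rightarrow> int \<Rightarrow> 'e set" where
  "Bsub a X r p q = jmap X (p + a) (q - a) `
     ker_of (Dsp X (p + a) (q - a)) (Dsp X (p + a + int r) (q - a - int r)) (ipow X r (p + a) (q - a))"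

definition Zsub :: "('k, 'd, 'e) couple \<Rightarrow> nat \<Rightarrow> int \<Rightarrow> int \<Rightarrow> 'e set" where
  "Zsub X r p q = {\<alpha> \<in> carrier (Esp X p q).
     kmap X p q \<alpha> \<in> ipow X r (p - 1 - int r) (q + int r) ` carrier (Dsp X (p - 1 - int r) (q + int r))}"

definition page ::
    "int \<Rightarrow> ('k, 'd, 'e) couple \<Rightarrow> nat \<Rightarrow> int \<Rightarrow> int \<Rightarrow> ('k, 'e set) module" where
  "page a X r p q = subquot (Esp X p q) (Zsub X r p q) (Bsub a X r p q)"

definition E_infty :: "int \<Rightarrow> ('k, 'd, 'e) couple \<Rightarrow> int \<Rightarrow> int \<Rightarrow> ('k, 'e set) module" where
  "E_infty a X p q = (THE V. \<forall>\<^sub>F r in sequentially. page a X r p q = V)"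

text \<open>The finite filtration \<open>F s \<subseteq> \<dots> \<subseteq> F t\<close> is extended to all integers by \<open>0\<close> below \<open>s\<close> and by
  \<open>H l\<close> above \<open>t\<close>, so that the condition on \<open>E\<^sup>\<infinity>\<close> makes sense in every bidegree
  (it forces \<open>E\<^sup>\<infinity>\<close> to vanish outside \<open>s < p \<le> t\<close>).\<close>

definition converges_to ::
    "'k ring \<Rightarrow> int \<Rightarrow> ('k, 'd, 'e) couple \<Rightarrow> (int \<Rightarrow> ('k, 'h) module) \<Rightarrow> bool" where
  "converges_to K a X H \<longleftrightarrow>
     (\<forall>l. \<exists>s t F. s \<le> t \<and>
        (\<forall>p. subspace K (F p) (H l)) \<and>
        (\<forall>p. F (p - 1) \<subseteq> F p) \<and>
        (\<forall>p\<le>s. F p = {\<zero>\<^bsub>H l\<^esub>}) \<and>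
        (\<forall>p\<ge>t. F p = carrier (H l)) \<and>
        (\<forall>p q. p + q = l \<longrightarrow> vs_iso K (E_infty a X p q) (subquot (H l) (F p) (F (p - 1)))))"


section \<open>The associated chain complex\<close>

text \<open>For \<open>c \<in> Z\<^sup>r / Z\<^sup>r\<^sup>+\<^sup>1\<close> in bidegree \<open>(p, q)\<close>: the class of \<open>j x\<close> in \<open>B\<^sup>r\<^sup>+\<^sup>1 / B\<^sup>r\<close>, in bidegree
  \<open>(p - 1 - r - a, q + r + a)\<close>, for any \<open>\<alpha>\<close> representing \<open>c\<close> and any \<open>x\<close> with \<open>k \<alpha> = i\<^sup>r x\<close>.\<close>

definition dbar ::
    "int \<Rightarrow> ('k, 'd, 'e) couple \<Rightarrow> nat \<Rightarrow> int \<Rightarrow> int \<Rightarrow> 'e set \<Rightarrow> 'e set" where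
  "dbar a X r p q c = (THE y. \<exists>\<alpha> \<in> Zsub X r p q.
     \<exists>x \<in> carrier (Dsp X (p - 1 - int r) (q + int r)).
       c = Zsub X (Suc r) p q +>\<^bsub>Esp X p q\<^esub> \<alpha> \<and>
       kmap X p q \<alpha> = ipow X r (p - 1 - int r) (q + int r) x \<and>
       y = Bsub a X r (p - 1 - int r - a) (q + int r + a)
             +>\<^bsub>Esp X (p - 1 - int r - a) (q + int r + a)\<^esub> jmap X (p - 1 - int r) (q + int r) x)"

definition stable_from :: "int \<Rightarrow> ('k, 'd, 'e) couple \<Rightarrow> nat \<Rightarrow> bool" where
  "stable_from a X N \<longleftrightarrow>
     (\<forall>r\<ge>N. \<forall>p q. Bsub a X r p q = Bsub a X (Suc r) p q \<and> Zsub X r p q = Zsub X (Suc r) p q)"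

text \<open>\<open>BB r\<close>, \<open>ZB\<close>, \<open>ZZ r\<close> index the summands \<open>B\<^sup>r\<^sup>+\<^sup>1/B\<^sup>r\<close>, \<open>Z\<^sup>N/B\<^sup>N\<close>, \<open>Z\<^sup>r/Z\<^sup>r\<^sup>+\<^sup>1\<close>.\<close>

datatype part = BB nat | ZB | ZZ nat

fun part_space ::
    "int \<Rightarrow> ('k, 'd, 'e) couple \<Rightarrow> nat \<Rightarrow> int \<times> int \<times> part \<Rightarrow> ('k, 'e set) module" where
  "part_space a X N (p, q, BB r) = subquot (Esp X p q) (Bsub a X (Suc r) p q) (Bsub a X r p q)"
| "part_space a X N (p, q, ZB) = subquot (Esp X p q) (Zsub X N p q) (Bsub a X N p q)"
| "part_space a X N (p, q, ZZ r) = subquot (Esp X p q) (Zsub X r p q) (Zsub X (Suc r) p q)"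

definition parts :: "nat \<Rightarrow> int \<Rightarrow> (int \<times> int \<times> part) set" where
  "parts N l = {(p, q, s). p + q = l \<and> s \<in> insert ZB (BB ` {..<N} \<union> ZZ ` {..<N})}"

definition Cplx ::
    "int \<Rightarrow> ('k, 'd, 'e) couple \<Rightarrow> nat \<Rightarrow> int \<Rightarrow> ('k, int \<times> int \<times> part \<Rightarrow> 'e set) module" where
  "Cplx a X N l = dsum (parts N l) (part_space a X N)"

text \<open>\<open>dbar\<close> with index \<open>r\<close> reaches bidegree \<open>(p, q)\<close> from \<open>(p + a + r + 1, q - a - r)\<close>.\<close>

definition Cdiff ::
    "int \<Rightarrow> ('k, 'd, 'e) couple \<Rightarrow> nat \<Rightarrow> int \<Rightarrow>
     (int \<times> int \<times> part \<Rightarrow> 'e set) \<Rightarrow> (int \<times> int \<times> part \<Rightarrow> 'e set)" where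
  "Cdiff a X N l f = (\<lambda>(p, q, s) \<in> parts N (l - 1).
     case s of
       BB r \<Rightarrow> dbar a X r (p + a + int r + 1) (q - a - int r)
                 (f (p + a + int r + 1, q - a - int r, ZZ r))
     | _ \<Rightarrow> \<zero>\<^bsub>part_space a X N (p, q, s)\<^esub>)"

end

theory Submission
  imports Defs
begin

text \<open>
  Since \<open>dbar\<close> is injective, the cycles of the complex are the families whose components in
  \<open>Z\<^sup>r / Z\<^sup>r\<^sup>+\<^sup>1\<close> vanish; since it is surjective, the boundaries are the families living on the summands
  \<open>B\<^sup>r\<^sup>+\<^sup>1 / B\<^sup>r\<close>. Hence projecting cycles to the summands \<open>Z\<^sup>N / B\<^sup>N = E\<^sup>\<infinity>\<close> identifies the homology in degree \<open>l\<close>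
  with the direct sum of the \<open>E\<^sup>\<infinity>\<^bsub>p,q\<^esub>\<close> with \<open>p + q = l\<close>, that is, of the graded pieces of \<open>H l\<close>. Over a field the
  filtration of \<open>H l\<close> splits, so this direct sum is isomorphic to \<open>H l\<close>. The complements
  used for the splitting come from Zorn's lemma.
\<close>

section \<open>Quotients and complements\<close>

text \<open>Exactness makes \<open>dbar\<close> bijective: its kernel is trivial because ker j = im
  i, and it is onto because ker i = im k. As \<open>dbar\<close> is a definite description,
  independence of the choices of alpha and x has to be settled before any value is known. Linearity
  of the differential is never established: cycles and boundaries are found component by component,
  from the value of \<open>dbar\<close> at zero, its trivial kernel and its image. Two finiteness
  points shape the rest. Elements of \<open>Cplx\<close> are finitely supported, so preimages under
  \<open>dbar\<close> have to vanish wherever the given component does; injectivity guarantees this.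
  And there are infinitely many \<open>ZB\<close> coordinates in each degree, while the filtration
  of \<open>H l\<close> has finitely many steps. Convergence makes the stable page vanish outside
  \<open>s < p \<le> t\<close>, so the projection can be restricted to this finite range without
  enlarging its kernel, and the splitting becomes an induction on the upper bound. Zorn's lemma
  gives complements in arbitrary vector spaces, so no dimension of \<open>H l\<close> has to be
  computed.\<close>

lemma linear_mapI:
  assumes "vectorspace K V" "vectorspace K W"
    and "\<And>v. v \<in> carrier V \<Longrightarrow> T v \<in> carrier W"
    and "\<And>v w. v \<in> carrier V \<Longrightarrow> w \<in> carrier V \<Longrightarrow> T (v \<oplus>\<^bsub>V\<^esub> w) = T v \<oplus>\<^bsub>W\<^esub> T w"
    and "\<And>c v. c \<in> carrier K \<Longrightarrow> v \<in> carrier V \<Longrightarrow> T (c \<odot>\<^bsub>V\<^esub> v) = c \<odot>\<^bsub>W\<^esub> T v"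
  shows "linear_map K V W T"
proof -
  interpret V: vectorspace K V by fact
  interpret W: vectorspace K W by fact
  show ?thesis
    by unfold_locales (auto simp: module_hom_def assms)
qed

lemma linear_map_restrict:
  assumes "linear_map K V W T" "subspace K U V"
  shows "linear_map K (V\<lparr>carrier := U\<rparr>) W T"
proof -
  interpret linear_map K V W T by fact
  have "U \<subseteq> carrier V"
    using assms(2) by (simp add: subspace_def submodule_def)
  then have "v \<in> carrier V" if "v \<in> U" for v
    using that by auto
  then show ?thesis
    using V.subspace_is_vs[OF assms(2)] by (intro linear_mapI) (auto intro: W.vectorspace_axioms)
qed

lemma vs_iso_sym:
  assumes "vs_iso K V W"
  shows "vs_iso K W V"
proof -
  obtain T where T: "linear_map K V W T" "bij_betw T (carrier V) (carrier W)"
    using assms by (auto simp: vs_iso_def)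
  interpret linear_map K V W T by fact
  let ?S = "inv_into (carrier V) T"
  have S: "bij_betw ?S (carrier W) (carrier V)"
    by (rule bij_betw_inv_into[OF T(2)])
  have *: "?S w \<in> carrier V" if "w \<in> carrier W" for w
    using S that by (auto simp: bij_betw_def)
  have **: "?S w = v" if "v \<in> carrier V" "T v = w" for v w
    using bij_betw_inv_into_left[OF T(2)] that by auto
  have ***: "T (?S w) = w" if "w \<in> carrier W" for w
    using bij_betw_inv_into_right[OF T(2)] that by auto
  have "linear_map K W V ?S"
    by (intro linear_mapI V.vectorspace_axioms W.vectorspace_axioms)
      (auto intro!: ** simp: * ***)
  with S show ?thesis by (auto simp: vs_iso_def)
qed

lemma vs_iso_trans [trans]:
  assumes "vs_iso K U V" "vs_iso K V W"
  shows "vs_iso K U W"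
proof -
  obtain S T where T: "linear_map K U V S" "bij_betw S (carrier U) (carrier V)"
     "linear_map K V W T" "bij_betw T (carrier V) (carrier W)"
    using assms by (auto simp: vs_iso_def)
  interpret S: linear_map K U V S by fact
  interpret T: linear_map K V W T by fact
  have "linear_map K U W (T \<circ> S)"
    by (intro linear_mapI S.V.vectorspace_axioms T.W.vectorspace_axioms) auto
  with bij_betw_trans[OF T(2) T(4)] show ?thesis by (auto simp: vs_iso_def)
qed

lemma linear_map_inj_onI:
  assumes "linear_map K V W T" "\<And>v. v \<in> carrier V \<Longrightarrow> T v = \<zero>\<^bsub>W\<^esub> \<Longrightarrow> v = \<zero>\<^bsub>V\<^esub>"
  shows "inj_on T (carrier V)"
proof -
  interpret linear_map K V W T by fact
  have "ker \<subseteq> {\<zero>\<^bsub>V\<^esub>}" using assms(2) by (auto simp: ker_def)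
  moreover have "\<zero>\<^bsub>V\<^esub> \<in> ker" by (simp add: ker_def)
  ultimately show ?thesis by (intro Ke0_imp_inj) auto
qed

lemma (in vectorspace) subspaceD:
  assumes "subspace K W V"
  shows "W \<subseteq> carrier V" "\<zero>\<^bsub>V\<^esub> \<in> W" "v \<in> W \<Longrightarrow> w \<in> W \<Longrightarrow> v \<oplus>\<^bsub>V\<^esub> w \<in> W"
    "c \<in> carrier K \<Longrightarrow> v \<in> W \<Longrightarrow> c \<odot>\<^bsub>V\<^esub> v \<in> W"
    "v \<in> W \<Longrightarrow> \<ominus>\<^bsub>V\<^esub> v \<in> W"
proof -
  interpret submodule K W V using assms by (simp add: subspace_def)
  show "W \<subseteq> carrier V" "\<zero>\<^bsub>V\<^esub> \<in> W" "v \<in> W \<Longrightarrow> w \<in> W \<Longrightarrow> v \<oplus>\<^bsub>V\<^esub> w \<in> W"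
    "c \<in> carrier K \<Longrightarrow> v \<in> W \<Longrightarrow> c \<odot>\<^bsub>V\<^esub> v \<in> W"
    using subset by auto
  show "\<ominus>\<^bsub>V\<^esub> v \<in> W" if "v \<in> W" for v
  proof -
    have "(\<ominus>\<^bsub>K\<^esub> \<one>\<^bsub>K\<^esub>) \<odot>\<^bsub>V\<^esub> v \<in> W"
      using that by (intro submodule.smult_closed[OF submodule_axioms]) auto
    then show ?thesis using that subset smult_minus_1[of v] by (metis subsetD)
  qed
qed

lemma (in vectorspace) subspaceI:
  assumes "W \<subseteq> carrier V" "\<zero>\<^bsub>V\<^esub> \<in> W" "\<And>v w. v \<in> W \<Longrightarrow> w \<in> W \<Longrightarrow> v \<oplus>\<^bsub>V\<^esub> w \<in> W"
    "\<And>c v. c \<in> carrier K \<Longrightarrow> v \<in> W \<Longrightarrow> c \<odot>\<^bsub>V\<^esub> v \<in> W"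
  shows "subspace K W V"
  by (auto intro!: subspace.intro submodule.intro vectorspace_axioms module_axioms assms subsetD[OF assms(1)])

text \<open>\<open>subquot V U W\<close> is a quotient of the record \<open>V\<close> with its
  carrier replaced by U; this makes W a subspace of that record.\<close>

lemma (in vectorspace) subspace_restrict:
  assumes "subspace K U V" "subspace K W V" "W \<subseteq> U"
  shows "subspace K W (V\<lparr>carrier := U\<rparr>)"
  using subspace_is_vs[OF assms(1)] subspaceD[OF assms(2)] assms(3)
  by (intro vectorspace.subspaceI) auto

section \<open>Quotients by cosets and the first isomorphism theorem\<close>

locale quotient_space = V?: vectorspace K V
  for K :: "'k ring" and V :: "('k, 'v) module" +
  fixes W :: "'v set"
  assumes W: "subspace K W V"
begin

lemma abelian_subgroup: "abelian_subgroup W V"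
proof (rule abelian_subgroupI3)
  show "additive_subgroup W V"
    by (rule additive_subgroupI, rule M.add.subgroupI)
       (use subspaceD[OF W] in \<open>auto simp: a_inv_def\<close>)
qed (rule M.abelian_group_axioms)

lemmas coset_self = abelian_subgroup.a_rcos_self[OF abelian_subgroup]

lemma coset_eq_iff:
  assumes "x \<in> carrier V" "y \<in> carrier V"
  shows "W +>\<^bsub>V\<^esub> x = W +>\<^bsub>V\<^esub> y \<longleftrightarrow> x \<ominus>\<^bsub>V\<^esub> y \<in> W"
  unfolding a_minus_def
  using abelian_subgroup.a_rcos_module[OF abelian_subgroup, of y x] coset_self[of x]
    abelian_subgroup.a_repr_independence'[OF abelian_subgroup, of x y] assms by auto

lemma coset_eq_self_iff: "x \<in> carrier V \<Longrightarrow> W +>\<^bsub>V\<^esub> x = W \<longleftrightarrow> x \<in> W"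
  using coset_self[of x] abelian_subgroup.a_rcos_const[OF abelian_subgroup, of x] by auto

text \<open>The scalar multiple of a coset is defined as a union over all its representatives. If v
  - x lies in W, so does c v - c x; hence every representative contributes the same coset, and the
  union, taken over a nonempty set, collapses.\<close>

lemma quot_space_simps:
  "carrier (quot_space V W) = (\<lambda>x. W +>\<^bsub>V\<^esub> x) ` carrier V"
  "\<zero>\<^bsub>quot_space V W\<^esub> = W"
  "x \<in> carrier V \<Longrightarrow> y \<in> carrier V \<Longrightarrow>
     (W +>\<^bsub>V\<^esub> x) \<oplus>\<^bsub>quot_space V W\<^esub> (W +>\<^bsub>V\<^esub> y) = W +>\<^bsub>V\<^esub> (x \<oplus>\<^bsub>V\<^esub> y)"
  "c \<in> carrier K \<Longrightarrow> x \<in> carrier V \<Longrightarrow>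
     c \<odot>\<^bsub>quot_space V W\<^esub> (W +>\<^bsub>V\<^esub> x) = W +>\<^bsub>V\<^esub> (c \<odot>\<^bsub>V\<^esub> x)"
proof -
  show "carrier (quot_space V W) = (\<lambda>x. W +>\<^bsub>V\<^esub> x) ` carrier V"
    by (auto simp: quot_space_def A_RCOSETS_def')
  show "\<zero>\<^bsub>quot_space V W\<^esub> = W" by (simp add: quot_space_def)
  show "x \<in> carrier V \<Longrightarrow> y \<in> carrier V \<Longrightarrow>
     (W +>\<^bsub>V\<^esub> x) \<oplus>\<^bsub>quot_space V W\<^esub> (W +>\<^bsub>V\<^esub> y) = W +>\<^bsub>V\<^esub> (x \<oplus>\<^bsub>V\<^esub> y)"
    by (simp add: quot_space_def abelian_subgroup.a_rcos_sum[OF abelian_subgroup])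
  assume c: "c \<in> carrier K" "x \<in> carrier V"
  have eq: "W +>\<^bsub>V\<^esub> (c \<odot>\<^bsub>V\<^esub> v) = W +>\<^bsub>V\<^esub> (c \<odot>\<^bsub>V\<^esub> x)" if v: "v \<in> W +>\<^bsub>V\<^esub> x" for v
  proof -
    obtain w where w: "w \<in> W" "v = w \<oplus>\<^bsub>V\<^esub> x" using v by (auto simp: a_r_coset_def')
    have "w \<in> carrier V" using w subspaceD(1)[OF W] by auto
    then have "c \<odot>\<^bsub>V\<^esub> v \<ominus>\<^bsub>V\<^esub> c \<odot>\<^bsub>V\<^esub> x = c \<odot>\<^bsub>V\<^esub> w"
      using c w by (simp add: smult_r_distr a_minus_def M.a_assoc M.r_neg)
    with c w \<open>w \<in> carrier V\<close> subspaceD(4)[OF W] show ?thesis by (subst coset_eq_iff) auto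
  qed
  have "W +>\<^bsub>V\<^esub> x \<noteq> {}" using coset_self[OF c(2)] by blast
  then show "c \<odot>\<^bsub>quot_space V W\<^esub> (W +>\<^bsub>V\<^esub> x) = W +>\<^bsub>V\<^esub> (c \<odot>\<^bsub>V\<^esub> x)"
    unfolding quot_space_def module.simps by (rule SUP_eq_const[OF _ eq])
qed

lemma vectorspace_quot_space: "vectorspace K (quot_space V W)"
proof (rule vs_criteria)
  show "field K" by (rule field.field_axioms)
  \<comment> \<open>With the zero W written as the coset of 0, the rules on representatives apply to
    it as well.\<close>
  have zero: "\<zero>\<^bsub>quot_space V W\<^esub> = W +>\<^bsub>V\<^esub> \<zero>\<^bsub>V\<^esub>"
    unfolding quot_space_simps(2) using coset_eq_self_iff[of "\<zero>\<^bsub>V\<^esub>"] subspaceD(2)[OF W] by simp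
  show "\<zero>\<^bsub>quot_space V W\<^esub> \<in> carrier (quot_space V W)"
    unfolding zero by (simp add: quot_space_simps(1,3,4))
  show "\<forall>v\<in>carrier (quot_space V W). v \<oplus>\<^bsub>quot_space V W\<^esub> \<zero>\<^bsub>quot_space V W\<^esub> = v"
    unfolding zero by (auto simp: quot_space_simps(1,3,4))
  show "\<forall>v\<in>carrier (quot_space V W). \<exists>w\<in>carrier (quot_space V W). v \<oplus>\<^bsub>quot_space V W\<^esub> w = \<zero>\<^bsub>quot_space V W\<^esub>"
    unfolding zero by (auto simp: quot_space_simps(1,3,4) M.r_neg intro!: bexI[of _ "\<ominus>\<^bsub>V\<^esub> _"])
qed (auto simp: quot_space_simps(1,3,4) smult_r_distr smult_l_distr smult_assoc1 M.a_ac)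

lemma linear_map_coset: "linear_map K V (quot_space V W) (\<lambda>x. W +>\<^bsub>V\<^esub> x)"
  by (intro linear_mapI vectorspace_axioms vectorspace_quot_space) (auto simp: quot_space_simps)

end

lemma ker_of_subspace:
  assumes "linear_map K V W T"
  shows "subspace K (ker_of V W T) V"
proof -
  interpret linear_map K V W T by fact
  show ?thesis by (rule V.subspaceI) (auto simp: ker_of_def)
qed

text \<open>First isomorphism theorem. T is constant on each coset of its kernel, so the image of a
  coset is a singleton and \<open>the_elem\<close> reads off the induced value without choosing a
  representative.\<close>

lemma vs_iso_quot_ker:
  assumes "linear_map K V W T" "T ` carrier V = carrier W"
  shows "vs_iso K (quot_space V (ker_of V W T)) W"
proof -
  interpret linear_map K V W T by fact
  define U where "U = ker_of V W T"
  interpret Q: quotient_space K V U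
    unfolding U_def using V.vectorspace_axioms ker_of_subspace[OF assms(1)]
    by (intro quotient_space.intro quotient_space_axioms.intro)
  define S where "S A = the_elem (T ` A)" for A
  have S: "S (U +>\<^bsub>V\<^esub> x) = T x" if x: "x \<in> carrier V" for x
  proof -
    have "T y = T x" if y: "y \<in> U +>\<^bsub>V\<^esub> x" for y
    proof -
      obtain u where "u \<in> U" "y = u \<oplus>\<^bsub>V\<^esub> x"
        using y by (auto simp: a_r_coset_def')
      moreover from this have "u \<in> carrier V" "T u = \<zero>\<^bsub>W\<^esub>"
        unfolding U_def ker_of_def by blast+
      ultimately show ?thesis using x f_add[of u x] by simp
    qed
    with Q.coset_self[OF x] have "T ` (U +>\<^bsub>V\<^esub> x) = {T x}" by blast
    then show ?thesis by (simp add: S_def)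
  qed
  have memU: "x \<in> U \<longleftrightarrow> x \<in> carrier V \<and> T x = \<zero>\<^bsub>W\<^esub>" for x
    by (simp add: U_def ker_of_def)
  have lin: "linear_map K (quot_space V U) W S"
    by (intro linear_mapI Q.vectorspace_quot_space W.vectorspace_axioms)
      (auto simp: Q.quot_space_simps S)
  have "inj_on S (carrier (quot_space V U))"
  proof (rule linear_map_inj_onI[OF lin])
    fix A assume "A \<in> carrier (quot_space V U)" and 0: "S A = \<zero>\<^bsub>W\<^esub>"
    then obtain x where x: "x \<in> carrier V" "A = U +>\<^bsub>V\<^esub> x"
      by (auto simp: Q.quot_space_simps)
    with 0 have "x \<in> U" by (simp add: S memU)
    with x show "A = \<zero>\<^bsub>quot_space V U\<^esub>"
      by (simp add: Q.quot_space_simps Q.coset_eq_self_iff)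
  qed
  moreover have "S ` carrier (quot_space V U) = carrier W"
    unfolding assms(2)[symmetric] by (auto simp: Q.quot_space_simps S image_iff)
  ultimately show ?thesis
    using lin unfolding U_def[symmetric] by (auto simp: vs_iso_def bij_betw_def)
qed

section \<open>Complements of subspaces and split extensions\<close>

lemma (in vectorspace) subspace_Union_chain:
  assumes "\<C> \<noteq> {}" "\<And>U. U \<in> \<C> \<Longrightarrow> subspace K U V"
    and chain: "\<And>A B. A \<in> \<C> \<Longrightarrow> B \<in> \<C> \<Longrightarrow> A \<subseteq> B \<or> B \<subseteq> A"
  shows "subspace K (\<Union>\<C>) V"
proof (rule subspaceI)
  fix v w assume "v \<in> \<Union>\<C>" "w \<in> \<Union>\<C>"
  then obtain A B where "A \<in> \<C>" "v \<in> A" "B \<in> \<C>" "w \<in> B" by auto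
  with chain[of A B] obtain C where C: "C \<in> \<C>" "v \<in> C" "w \<in> C" by blast
  with subspaceD(3)[OF assms(2)[OF C(1)]] show "v \<oplus>\<^bsub>V\<^esub> w \<in> \<Union>\<C>" by auto
qed (use assms(1) subspaceD(1,2,4)[OF assms(2)] in blast)+

text \<open>Zorn's lemma is applied to the subspaces meeting W only in zero; unions of chains stay
  in this family. A maximal member U satisfies U + W = V, since a vector outside U + W could be
  added to U without creating a new intersection with W.\<close>

lemma (in vectorspace) complement_exists:
  assumes W: "subspace K W V"
  obtains U where "subspace K U V" "U \<inter> W = {\<zero>\<^bsub>V\<^esub>}"
    "\<And>v. v \<in> carrier V \<Longrightarrow> \<exists>u\<in>U. \<exists>w\<in>W. v = u \<oplus>\<^bsub>V\<^esub> w"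
proof -
  let ?A = "{U. subspace K U V \<and> U \<inter> W = {\<zero>\<^bsub>V\<^esub>}}"
  have "\<exists>M\<in>?A. \<forall>X\<in>?A. M \<subseteq> X \<longrightarrow> X = M"
  proof (rule subset_Zorn_nonempty)
    have "subspace K {\<zero>\<^bsub>V\<^esub>} V" by (rule subspaceI) auto
    then show "?A \<noteq> {}" using subspaceD(2)[OF W] by blast
  next
    fix \<C> assume \<C>: "\<C> \<noteq> {}" "subset.chain ?A \<C>"
    then have "subspace K (\<Union>\<C>) V"
      by (intro subspace_Union_chain) (auto simp: subset_chain_def)
    moreover have "\<Union>\<C> \<inter> W = {\<zero>\<^bsub>V\<^esub>}"
      using \<C> by (auto simp: subset_chain_def)
    ultimately show "\<Union>\<C> \<in> ?A" by simp
  qed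
  then obtain U where U: "subspace K U V" "U \<inter> W = {\<zero>\<^bsub>V\<^esub>}"
    and max: "\<And>X. subspace K X V \<Longrightarrow> X \<inter> W = {\<zero>\<^bsub>V\<^esub>} \<Longrightarrow> U \<subseteq> X \<Longrightarrow> X = U"
    by auto
  note Uc = subsetD[OF subspaceD(1)[OF U(1)]] and Wc = subsetD[OF subspaceD(1)[OF W]]
  have "\<exists>u\<in>U. \<exists>w\<in>W. v = u \<oplus>\<^bsub>V\<^esub> w" if v: "v \<in> carrier V" for v
  proof (rule ccontr)
    assume contra: "\<not> ?thesis"
    \<comment> \<open>The span of U and v, which is to contradict the maximality of U.\<close>
    let ?X = "{u \<oplus>\<^bsub>V\<^esub> c \<odot>\<^bsub>V\<^esub> v | u c. u \<in> U \<and> c \<in> carrier K}"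
    have "subspace K ?X V"
    proof (rule subspaceI)
      show "?X \<subseteq> carrier V" using Uc v by auto
      show "\<zero>\<^bsub>V\<^esub> \<in> ?X" using subspaceD(2)[OF U(1)] v
        by (auto intro!: exI[of _ "\<zero>\<^bsub>V\<^esub>"] exI[of _ "\<zero>\<^bsub>K\<^esub>"])
    next
      fix x y assume "x \<in> ?X" "y \<in> ?X"
      then obtain u c u' c' where *: "u \<in> U" "c \<in> carrier K" "x = u \<oplus>\<^bsub>V\<^esub> c \<odot>\<^bsub>V\<^esub> v"
        "u' \<in> U" "c' \<in> carrier K" "y = u' \<oplus>\<^bsub>V\<^esub> c' \<odot>\<^bsub>V\<^esub> v" by auto
      then have "x \<oplus>\<^bsub>V\<^esub> y = (u \<oplus>\<^bsub>V\<^esub> u') \<oplus>\<^bsub>V\<^esub> (c \<oplus>\<^bsub>K\<^esub> c') \<odot>\<^bsub>V\<^esub> v"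
        using v by (simp add: Uc smult_l_distr M.a_ac)
      with * show "x \<oplus>\<^bsub>V\<^esub> y \<in> ?X" using subspaceD(3)[OF U(1)] by blast
    next
      fix d x assume d: "d \<in> carrier K" and "x \<in> ?X"
      then obtain u c where *: "u \<in> U" "c \<in> carrier K" "x = u \<oplus>\<^bsub>V\<^esub> c \<odot>\<^bsub>V\<^esub> v"
        by auto
      then have "d \<odot>\<^bsub>V\<^esub> x = d \<odot>\<^bsub>V\<^esub> u \<oplus>\<^bsub>V\<^esub> (d \<otimes>\<^bsub>K\<^esub> c) \<odot>\<^bsub>V\<^esub> v"
        using v d by (simp add: Uc smult_r_distr smult_assoc1)
      with * d show "d \<odot>\<^bsub>V\<^esub> x \<in> ?X" using subspaceD(4)[OF U(1)] by blast
    qed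
    moreover have "?X \<inter> W = {\<zero>\<^bsub>V\<^esub>}"
    proof -
      have "x = \<zero>\<^bsub>V\<^esub>" if x: "x \<in> W" "u \<in> U" "c \<in> carrier K" "x = u \<oplus>\<^bsub>V\<^esub> c \<odot>\<^bsub>V\<^esub> v" for x u c
      \<comment> \<open>If c is nonzero, dividing x = u + c v by c exhibits v as an element of U +
        W, against the choice of v. If c is zero, x lies in U and W.\<close>
      proof (cases "c = \<zero>\<^bsub>K\<^esub>")
        case True
        then have "x = u" using x v Uc by simp
        then show ?thesis using U(2) x by auto
      next
        case False
        then have c: "inv\<^bsub>K\<^esub> c \<in> carrier K" "inv\<^bsub>K\<^esub> c \<otimes>\<^bsub>K\<^esub> c = \<one>\<^bsub>K\<^esub>"
          using x(3) by (auto simp: field_Units)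
        have eq: "c \<odot>\<^bsub>V\<^esub> v = \<ominus>\<^bsub>V\<^esub> u \<oplus>\<^bsub>V\<^esub> x"
          using x v Uc by (simp add: M.r_neg1)
        then have "inv\<^bsub>K\<^esub> c \<odot>\<^bsub>V\<^esub> (c \<odot>\<^bsub>V\<^esub> v) = inv\<^bsub>K\<^esub> c \<odot>\<^bsub>V\<^esub> (\<ominus>\<^bsub>V\<^esub> u) \<oplus>\<^bsub>V\<^esub> inv\<^bsub>K\<^esub> c \<odot>\<^bsub>V\<^esub> x"
          unfolding eq using c x(1,2) Uc Wc by (intro smult_r_distr) auto
        then have "v = inv\<^bsub>K\<^esub> c \<odot>\<^bsub>V\<^esub> (\<ominus>\<^bsub>V\<^esub> u) \<oplus>\<^bsub>V\<^esub> inv\<^bsub>K\<^esub> c \<odot>\<^bsub>V\<^esub> x"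
          using c x(3) v by (simp add: smult_assoc1[symmetric])
        then show ?thesis
          using contra subspaceD(4,5)[OF U(1)] subspaceD(4)[OF W] c x by blast
      qed
      moreover have "\<zero>\<^bsub>V\<^esub> \<in> ?X" using subspaceD(2)[OF U(1)] v
        by (auto intro!: exI[of _ "\<zero>\<^bsub>V\<^esub>"] exI[of _ "\<zero>\<^bsub>K\<^esub>"])
      ultimately show ?thesis using subspaceD(2)[OF W] by blast
    qed
    moreover have "U \<subseteq> ?X"
    proof
      fix u assume "u \<in> U"
      then show "u \<in> ?X" using v Uc by (auto intro!: exI[of _ u] exI[of _ "\<zero>\<^bsub>K\<^esub>"])
    qed
    ultimately have "?X = U" by (rule max)
    moreover have "v \<in> ?X" using v subspaceD(2)[OF U(1)]
      by (auto intro!: exI[of _ "\<zero>\<^bsub>V\<^esub>"] exI[of _ "\<one>\<^bsub>K\<^esub>"])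
    ultimately have "v \<in> U" by simp
    then show False using contra v subspaceD(2)[OF W] by (metis M.r_zero)
  qed
  with U that show ?thesis by blast
qed

text \<open>The extension of V/W by W splits: a complement U of W maps bijectively onto V/W, so N
  can be moved into V as U. The sum map (m, n) to f m + g n is injective since U and W meet in zero,
  and onto since U + W = V.\<close>

lemma vs_iso_direct_sum:
  assumes "vectorspace K V" "subspace K W V"
    and "vs_iso K M (V\<lparr>carrier := W\<rparr>)" "vs_iso K N (quot_space V W)"
  shows "vs_iso K (direct_sum M N) V"
proof -
  interpret quotient_space K V W
    using assms(1,2) by (intro quotient_space.intro quotient_space_axioms.intro)
  obtain U where U: "subspace K U V" "U \<inter> W = {\<zero>\<^bsub>V\<^esub>}"
    "\<And>v. v \<in> carrier V \<Longrightarrow> \<exists>u\<in>U. \<exists>w\<in>W. v = u \<oplus>\<^bsub>V\<^esub> w"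
    using complement_exists[OF W] by blast
  note Uc = subsetD[OF subspaceD(1)[OF U(1)]] and Wc = subsetD[OF subspaceD(1)[OF W]]
  let ?c = "\<lambda>x. W +>\<^bsub>V\<^esub> x"
  have c: "linear_map K (V\<lparr>carrier := U\<rparr>) (quot_space V W) ?c"
    by (rule linear_map_restrict[OF linear_map_coset U(1)])
  have "inj_on ?c U"
    using linear_map_inj_onI[OF c] U(2) by (auto simp: quot_space_simps coset_eq_self_iff Uc)
  moreover have "?c ` U = carrier (quot_space V W)"
  proof -
    have "?c v \<in> ?c ` U" if "v \<in> carrier V" for v
    proof -
      obtain u w where uw: "u \<in> U" "w \<in> W" "v = u \<oplus>\<^bsub>V\<^esub> w" using U(3)[OF \<open>v \<in> carrier V\<close>] by blast
      then have "v \<ominus>\<^bsub>V\<^esub> u = w"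
        using Uc Wc by (simp add: a_minus_def M.a_comm[of u w] M.a_assoc M.r_neg)
      then have "?c v = ?c u" using coset_eq_iff[of v u] uw \<open>v \<in> carrier V\<close> Uc by auto
      with uw show ?thesis by auto
    qed
    then show ?thesis using Uc by (auto simp: quot_space_simps)
  qed
  ultimately have "vs_iso K (V\<lparr>carrier := U\<rparr>) (quot_space V W)"
    using c by (auto simp: vs_iso_def bij_betw_def)
  then have "vs_iso K N (V\<lparr>carrier := U\<rparr>)"
    using vs_iso_trans[OF assms(4) vs_iso_sym] by blast
  then obtain f g where f: "linear_map K M (V\<lparr>carrier := W\<rparr>) f" "bij_betw f (carrier M) W"
    and g: "linear_map K N (V\<lparr>carrier := U\<rparr>) g" "bij_betw g (carrier N) U"
    using assms(3) by (auto simp: vs_iso_def)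
  interpret f: linear_map K M "V\<lparr>carrier := W\<rparr>" f by fact
  interpret g: linear_map K N "V\<lparr>carrier := U\<rparr>" g by fact
  have fc: "f m \<in> W" if "m \<in> carrier M" for m using f.f_im[OF that] by simp
  have gc: "g m \<in> U" if "m \<in> carrier N" for m using g.f_im[OF that] by simp
  let ?T = "\<lambda>(m, n). f m \<oplus>\<^bsub>V\<^esub> g n"
  have f0: "m = \<zero>\<^bsub>M\<^esub>" if "m \<in> carrier M" "f m = \<zero>\<^bsub>V\<^esub>" for m
    using f(2) that f.f0_is_0 by (auto simp: bij_betw_def inj_on_def)
  have g0: "m = \<zero>\<^bsub>N\<^esub>" if "m \<in> carrier N" "g m = \<zero>\<^bsub>V\<^esub>" for m
    using g(2) that g.f0_is_0 by (auto simp: bij_betw_def inj_on_def)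
  have lin: "linear_map K (direct_sum M N) V ?T"
  proof (rule linear_mapI)
    show "vectorspace K (direct_sum M N)"
      by (rule direct_sum_is_vs[OF f.V.vectorspace_axioms g.V.vectorspace_axioms])
  qed (use f.f_add g.f_add f.f_smult g.f_smult
    in \<open>auto simp: direct_sum_def fc gc Uc Wc vectorspace_axioms M.a_ac smult_r_distr\<close>)
  moreover have "inj_on ?T (carrier (direct_sum M N))"
  proof (rule linear_map_inj_onI[OF lin], clarify)
    fix m n assume "(m, n) \<in> carrier (direct_sum M N)" and 0: "f m \<oplus>\<^bsub>V\<^esub> g n = \<zero>\<^bsub>V\<^esub>"
    then have m: "m \<in> carrier M" "n \<in> carrier N" by (auto simp: direct_sum_def)
    then have "g n = \<ominus>\<^bsub>V\<^esub> f m"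
      using 0 fc gc Wc Uc by (metis M.minus_equality M.a_comm)
    then have "g n \<in> W" using m fc subspaceD(5)[OF W] by simp
    then have "g n \<in> U \<inter> W" using m gc by blast
    then have "g n = \<zero>\<^bsub>V\<^esub>" using U by auto
    moreover from this have "f m = \<zero>\<^bsub>V\<^esub>" using 0 m fc Wc by simp
    ultimately show "(m, n) = \<zero>\<^bsub>direct_sum M N\<^esub>"
      using f0 g0 m by (simp add: direct_sum_def)
  qed
  moreover have "?T ` carrier (direct_sum M N) = carrier V"
  proof -
    have "v \<in> ?T ` carrier (direct_sum M N)" if "v \<in> carrier V" for v
    proof -
      obtain u w where uw: "u \<in> U" "w \<in> W" "v = u \<oplus>\<^bsub>V\<^esub> w" using U(3)[OF \<open>v \<in> carrier V\<close>] by blast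
      then obtain m n where "m \<in> carrier M" "n \<in> carrier N" "f m = w" "g n = u"
        using f(2) g(2) by (auto simp: bij_betw_def)
      then show ?thesis using uw
        by (intro image_eqI[of _ _ "(m, n)"]) (auto simp: direct_sum_def M.a_comm Uc Wc)
    qed
    then show ?thesis by (auto simp: direct_sum_def fc gc Uc Wc)
  qed
  ultimately show ?thesis by (auto simp: vs_iso_def bij_betw_def)
qed

section \<open>Direct sums and filtrations\<close>

lemma mem_dsum_iff:
  "f \<in> carrier (dsum I M) \<longleftrightarrow>
     f \<in> extensional I \<and> (\<forall>i\<in>I. f i \<in> carrier (M i)) \<and> finite {i \<in> I. f i \<noteq> \<zero>\<^bsub>M i\<^esub>}"
  by (auto simp: dsum_def PiE_def)

lemma dsum_ops:
  "\<zero>\<^bsub>dsum I M\<^esub> = (\<lambda>i\<in>I. \<zero>\<^bsub>M i\<^esub>)"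
  "f \<oplus>\<^bsub>dsum I M\<^esub> g = (\<lambda>i\<in>I. f i \<oplus>\<^bsub>M i\<^esub> g i)"
  "c \<odot>\<^bsub>dsum I M\<^esub> f = (\<lambda>i\<in>I. c \<odot>\<^bsub>M i\<^esub> f i)"
  by (simp_all add: dsum_def)

text \<open>The axioms hold in each coordinate. Finite support is kept because the support of f + g
  lies in the union of the two supports, and those of c f and -f lie in that of f.\<close>

lemma vectorspace_dsum:
  assumes "field K" and M: "\<And>i. i \<in> I \<Longrightarrow> vectorspace K (M i)"
  shows "vectorspace K (dsum I M)"
proof (rule vs_criteria)
  note ag = module.axioms(2)[OF vectorspace.axioms(1)[OF M]]
  note mo = vectorspace.axioms(1)[OF M]
  have am: "abelian_monoid (M i)" if "i \<in> I" for i
    using ag[OF that] by (rule abelian_group.axioms)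
  note simps = mem_dsum_iff dsum_ops
  have z: "\<zero>\<^bsub>M i\<^esub> \<in> carrier (M i)" if "i \<in> I" for i
    using am[OF that] by (rule abelian_monoid.zero_closed)
  show "\<zero>\<^bsub>dsum I M\<^esub> \<in> carrier (dsum I M)"
    by (auto simp: simps z)
  show "\<forall>v w. v \<in> carrier (dsum I M) \<and> w \<in> carrier (dsum I M) \<longrightarrow> v \<oplus>\<^bsub>dsum I M\<^esub> w \<in> carrier (dsum I M)"
  proof (intro allI impI, elim conjE)
    fix f g assume f: "f \<in> carrier (dsum I M)" and g: "g \<in> carrier (dsum I M)"
    have "{i \<in> I. (\<lambda>i\<in>I. f i \<oplus>\<^bsub>M i\<^esub> g i) i \<noteq> \<zero>\<^bsub>M i\<^esub>} \<subseteq> {i \<in> I. f i \<noteq> \<zero>\<^bsub>M i\<^esub>} \<union> {i \<in> I. g i \<noteq> \<zero>\<^bsub>M i\<^esub>}"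
      using abelian_monoid.l_zero[OF am z] by auto
    moreover have "finite ({i \<in> I. f i \<noteq> \<zero>\<^bsub>M i\<^esub>} \<union> {i \<in> I. g i \<noteq> \<zero>\<^bsub>M i\<^esub>})"
      using f g by (simp add: simps)
    ultimately have "finite {i \<in> I. (\<lambda>i\<in>I. f i \<oplus>\<^bsub>M i\<^esub> g i) i \<noteq> \<zero>\<^bsub>M i\<^esub>}"
      by (rule finite_subset)
    then show "f \<oplus>\<^bsub>dsum I M\<^esub> g \<in> carrier (dsum I M)"
      using f g abelian_monoid.a_closed[OF am] by (simp add: simps)
  qed
  show "\<forall>c v. c \<in> carrier K \<and> v \<in> carrier (dsum I M) \<longrightarrow> c \<odot>\<^bsub>dsum I M\<^esub> v \<in> carrier (dsum I M)"
  proof (intro allI impI, elim conjE)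
    fix c f assume c: "c \<in> carrier K" and f: "f \<in> carrier (dsum I M)"
    have "{i \<in> I. (\<lambda>i\<in>I. c \<odot>\<^bsub>M i\<^esub> f i) i \<noteq> \<zero>\<^bsub>M i\<^esub>} \<subseteq> {i \<in> I. f i \<noteq> \<zero>\<^bsub>M i\<^esub>}"
      using module.smult_r_null[OF mo c] by auto
    moreover have "finite {i \<in> I. f i \<noteq> \<zero>\<^bsub>M i\<^esub>}"
      using f by (simp add: simps)
    ultimately have "finite {i \<in> I. (\<lambda>i\<in>I. c \<odot>\<^bsub>M i\<^esub> f i) i \<noteq> \<zero>\<^bsub>M i\<^esub>}"
      by (rule finite_subset)
    then show "c \<odot>\<^bsub>dsum I M\<^esub> f \<in> carrier (dsum I M)"
      using f module.smult_closed[OF mo c] by (simp add: simps)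
  qed
  show "\<forall>f\<in>carrier (dsum I M). \<exists>g\<in>carrier (dsum I M). f \<oplus>\<^bsub>dsum I M\<^esub> g = \<zero>\<^bsub>dsum I M\<^esub>"
  proof
    fix f assume f: "f \<in> carrier (dsum I M)"
    define g where "g = (\<lambda>i\<in>I. \<ominus>\<^bsub>M i\<^esub> f i)"
    have "\<ominus>\<^bsub>M i\<^esub> \<zero>\<^bsub>M i\<^esub> = \<zero>\<^bsub>M i\<^esub>" if "i \<in> I" for i
      using abelian_group.minus_equality[OF ag[OF that], of "\<zero>\<^bsub>M i\<^esub>" "\<zero>\<^bsub>M i\<^esub>"] z that
        abelian_monoid.l_zero[OF am z] by simp
    then have "{i \<in> I. g i \<noteq> \<zero>\<^bsub>M i\<^esub>} \<subseteq> {i \<in> I. f i \<noteq> \<zero>\<^bsub>M i\<^esub>}"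
      by (auto simp: g_def)
    moreover have "finite {i \<in> I. f i \<noteq> \<zero>\<^bsub>M i\<^esub>}"
      using f by (simp add: simps)
    ultimately have fin: "finite {i \<in> I. g i \<noteq> \<zero>\<^bsub>M i\<^esub>}"
      by (rule finite_subset)
    have "g i \<in> carrier (M i)" "f i \<oplus>\<^bsub>M i\<^esub> g i = \<zero>\<^bsub>M i\<^esub>" if i: "i \<in> I" for i
      using f i abelian_group.r_neg[OF ag[OF i]] abelian_group.a_inv_closed[OF ag[OF i]]
      by (auto simp: simps g_def)
    with fin have "g \<in> carrier (dsum I M)" "f \<oplus>\<^bsub>dsum I M\<^esub> g = \<zero>\<^bsub>dsum I M\<^esub>"
      unfolding simps by (auto simp: g_def cong: restrict_cong)
    then show "\<exists>g\<in>carrier (dsum I M). f \<oplus>\<^bsub>dsum I M\<^esub> g = \<zero>\<^bsub>dsum I M\<^esub>" by blast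
  qed
  show "\<forall>f\<in>carrier (dsum I M). f \<oplus>\<^bsub>dsum I M\<^esub> \<zero>\<^bsub>dsum I M\<^esub> = f"
    by (auto simp: simps fun_eq_iff extensional_def abelian_monoid.r_zero[OF am])
  show "\<forall>f\<in>carrier (dsum I M). \<one>\<^bsub>K\<^esub> \<odot>\<^bsub>dsum I M\<^esub> f = f"
    by (auto simp: simps fun_eq_iff extensional_def module.smult_one[OF mo])
  show "\<forall>v w. v \<in> carrier (dsum I M) \<and> w \<in> carrier (dsum I M) \<longrightarrow>
      v \<oplus>\<^bsub>dsum I M\<^esub> w = w \<oplus>\<^bsub>dsum I M\<^esub> v"
    using abelian_monoid.a_comm[OF am] by (auto simp: simps intro!: restrict_ext)
  show "\<forall>v w x. v \<in> carrier (dsum I M) \<and> w \<in> carrier (dsum I M) \<and> x \<in> carrier (dsum I M) \<longrightarrow>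
      (v \<oplus>\<^bsub>dsum I M\<^esub> w) \<oplus>\<^bsub>dsum I M\<^esub> x = v \<oplus>\<^bsub>dsum I M\<^esub> (w \<oplus>\<^bsub>dsum I M\<^esub> x)"
    using abelian_monoid.a_assoc[OF am] by (auto simp: simps intro!: restrict_ext)
  show "\<forall>a b v. a \<in> carrier K \<and> b \<in> carrier K \<and> v \<in> carrier (dsum I M) \<longrightarrow>
      (a \<otimes>\<^bsub>K\<^esub> b) \<odot>\<^bsub>dsum I M\<^esub> v = a \<odot>\<^bsub>dsum I M\<^esub> (b \<odot>\<^bsub>dsum I M\<^esub> v)"
    using module.smult_assoc1[OF mo] by (auto simp: simps intro!: restrict_ext)
  show "\<forall>a b v. a \<in> carrier K \<and> b \<in> carrier K \<and> v \<in> carrier (dsum I M) \<longrightarrow>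
      (a \<oplus>\<^bsub>K\<^esub> b) \<odot>\<^bsub>dsum I M\<^esub> v = a \<odot>\<^bsub>dsum I M\<^esub> v \<oplus>\<^bsub>dsum I M\<^esub> b \<odot>\<^bsub>dsum I M\<^esub> v"
    using module.smult_l_distr[OF mo] by (auto simp: simps intro!: restrict_ext)
  show "\<forall>a v w. a \<in> carrier K \<and> v \<in> carrier (dsum I M) \<and> w \<in> carrier (dsum I M) \<longrightarrow>
      a \<odot>\<^bsub>dsum I M\<^esub> (v \<oplus>\<^bsub>dsum I M\<^esub> w) = a \<odot>\<^bsub>dsum I M\<^esub> v \<oplus>\<^bsub>dsum I M\<^esub> a \<odot>\<^bsub>dsum I M\<^esub> w"
    using module.smult_r_distr[OF mo] by (auto simp: simps intro!: restrict_ext)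
qed fact

text \<open>Splits off one coordinate, in the shape \<open>direct_sum\<close> of rest and new piece
  that \<open>vs_iso_direct_sum\<close> expects; function update is the inverse.\<close>

lemma vs_iso_dsum_insert:
  assumes "field K" "\<And>j. j \<in> insert i I \<Longrightarrow> vectorspace K (M j)" "i \<notin> I"
  shows "vs_iso K (dsum (insert i I) M) (direct_sum (dsum I M) (M i))"
proof -
  let ?T = "\<lambda>f. (restrict f I, f i)"
  let ?A = "carrier (dsum (insert i I) M)" and ?B = "carrier (direct_sum (dsum I M) (M i))"
  have T: "?T f \<in> ?B" if f: "f \<in> ?A" for f
  proof -
    have "finite {j \<in> I. restrict f I j \<noteq> \<zero>\<^bsub>M j\<^esub>}"
      by (rule finite_subset[of _ "{j \<in> insert i I. f j \<noteq> \<zero>\<^bsub>M j\<^esub>}"])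
         (use f in \<open>auto simp: mem_dsum_iff\<close>)
    with f show ?thesis by (auto simp: mem_dsum_iff direct_sum_def)
  qed
  have "linear_map K (dsum (insert i I) M) (direct_sum (dsum I M) (M i)) ?T"
  proof (rule linear_mapI)
    show "vectorspace K (dsum (insert i I) M)"
      using assms by (intro vectorspace_dsum) auto
    show "vectorspace K (direct_sum (dsum I M) (M i))"
      using assms by (intro direct_sum_is_vs vectorspace_dsum) auto
  qed (use T in \<open>auto simp: direct_sum_def dsum_ops restrict_def fun_eq_iff\<close>)
  moreover have "bij_betw ?T ?A ?B"
  proof (rule bij_betw_byWitness[where f' = "\<lambda>(g, x). g(i := x)"])
    show "\<forall>f\<in>?A. (\<lambda>(g, x). g(i := x)) (?T f) = f"
      by (auto simp: mem_dsum_iff extensional_def fun_eq_iff)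
    show "\<forall>p\<in>?B. ?T ((\<lambda>(g, x). g(i := x)) p) = p"
      using assms(3) by (auto simp: direct_sum_def mem_dsum_iff extensional_def fun_eq_iff)
    show "?T ` ?A \<subseteq> ?B" using T by auto
    have "g(i := x) \<in> ?A" if g: "g \<in> carrier (dsum I M)" and x: "x \<in> carrier (M i)" for g x
    proof -
      have "finite {j \<in> insert i I. (g(i := x)) j \<noteq> \<zero>\<^bsub>M j\<^esub>}"
        by (rule finite_subset[of _ "insert i {j \<in> I. g j \<noteq> \<zero>\<^bsub>M j\<^esub>}"])
           (use g in \<open>auto simp: mem_dsum_iff\<close>)
      with g x show ?thesis by (auto simp: mem_dsum_iff extensional_def)
    qed
    then show "(\<lambda>(g, x). g(i := x)) ` ?B \<subseteq> ?A" by (auto simp: direct_sum_def)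
  qed
  ultimately show ?thesis by (auto simp: vs_iso_def)
qed

text \<open>Induction on t: passing to t + 1 adds the summand \<open>M (t + 1)\<close>, which is the
  quotient of F (t + 1) by F t, and the extension splits. The range starts just after s because F s
  is zero.\<close>

lemma vs_iso_filtration:
  fixes V :: "('k, 'v) module" and F :: "int \<Rightarrow> 'v set"
  assumes V: "vectorspace K V" and F: "\<And>p. subspace K (F p) V" "\<And>p. F (p - 1) \<subseteq> F p"
    and s: "F s = {\<zero>\<^bsub>V\<^esub>}"
    and M: "\<And>p. s < p \<Longrightarrow> vs_iso K (M p) (subquot V (F p) (F (p - 1)))"
    and "s \<le> t"
  shows "vs_iso K (dsum {s<..t} M) (V\<lparr>carrier := F t\<rparr>)"
  using \<open>s \<le> t\<close>
proof (induction t rule: int_ge_induct)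
  case base
  interpret V: vectorspace K V by fact
  have "linear_map K (dsum {} M) (V\<lparr>carrier := {\<zero>\<^bsub>V\<^esub>}\<rparr>) (\<lambda>_. \<zero>\<^bsub>V\<^esub>)"
  proof (rule linear_mapI)
    show "vectorspace K (dsum {} M)" by (rule vectorspace_dsum) (auto intro: V.field_axioms)
    show "vectorspace K (V\<lparr>carrier := {\<zero>\<^bsub>V\<^esub>}\<rparr>)" using V.subspace_is_vs[OF F(1)[of s]] s by simp
  qed auto
  \<comment> \<open>Families over the empty index set are extensional, so there is exactly one, the
    everywhere \<open>undefined\<close> function.\<close>
  moreover have "carrier (dsum {} M) = {\<lambda>_. undefined}"
    by (auto simp: mem_dsum_iff)
  ultimately show ?case using s by (auto simp: vs_iso_def bij_betw_def)
next
  case (step t)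
  interpret V: vectorspace K V by fact
  \<comment> \<open>\<open>vs_iso\<close> already contains this: a \<open>linear_map\<close> carries
    the vector space axioms of its source.\<close>
  have M_vs: "vectorspace K (M p)" if "s < p" for p
    using M[OF that] by (auto simp: vs_iso_def linear_map_def)
  have "{s<..t + 1} = insert (t + 1) {s<..t}" using step.hyps by auto
  then have "vs_iso K (dsum {s<..t + 1} M) (direct_sum (dsum {s<..t} M) (M (t + 1)))"
    using step.hyps V.field_axioms by (auto intro!: vs_iso_dsum_insert M_vs)
  also have "vs_iso K (direct_sum (dsum {s<..t} M) (M (t + 1))) (V\<lparr>carrier := F (t + 1)\<rparr>)"
  proof (rule vs_iso_direct_sum)
    show "vectorspace K (V\<lparr>carrier := F (t + 1)\<rparr>)" by (rule V.subspace_is_vs[OF F(1)])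
    show "subspace K (F t) (V\<lparr>carrier := F (t + 1)\<rparr>)"
      using F(2)[of "t + 1"] by (intro V.subspace_restrict F(1)) simp
    show "vs_iso K (dsum {s<..t} M) (V\<lparr>carrier := F (t + 1)\<rparr>\<lparr>carrier := F t\<rparr>)"
      using step.IH by simp
    show "vs_iso K (M (t + 1)) (quot_space (V\<lparr>carrier := F (t + 1)\<rparr>) (F t))"
      using M[of "t + 1"] step.hyps by (simp add: subquot_def)
  qed
  finally show ?case .
qed

section \<open>Cycles and boundaries of an exact couple\<close>

lemma (in vectorspace) carrier_subspace: "subspace K (carrier V) V"
  by (rule subspaceI) auto

lemma linear_map_image_subspace:
  assumes "linear_map K V W T" "subspace K U V"
  shows "subspace K (T ` U) W"
proof -
  interpret linear_map K V W T by fact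
  note U = V.subspaceD[OF assms(2)]
  show ?thesis
  proof (rule W.subspaceI)
    show "T ` U \<subseteq> carrier W" using U(1) by auto
    show "\<zero>\<^bsub>W\<^esub> \<in> T ` U" using U(2) f0_is_0 by (metis imageI)
  next
    fix v w assume "v \<in> T ` U" "w \<in> T ` U"
    then obtain x y where "x \<in> U" "y \<in> U" and vw: "v = T x" "w = T y" by (elim imageE)
    then show "v \<oplus>\<^bsub>W\<^esub> w \<in> T ` U"
      unfolding vw using U(1,3) by (subst f_add[symmetric]) auto
  next
    fix c v assume c: "c \<in> carrier K" and "v \<in> T ` U"
    then obtain x where "x \<in> U" and v: "v = T x" by (elim imageE)
    with c show "c \<odot>\<^bsub>W\<^esub> v \<in> T ` U"
      unfolding v using U(1,4) by (subst f_smult[symmetric]) auto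
  qed
qed

lemma linear_map_vimage_subspace:
  assumes "linear_map K V W T" "subspace K U W"
  shows "subspace K {v \<in> carrier V. T v \<in> U} V"
proof -
  interpret linear_map K V W T by fact
  note U = W.subspaceD[OF assms(2)]
  show ?thesis
    by (rule V.subspaceI) (auto simp: U(2-4))
qed

text \<open>Cosets depend on the addition only, which a change of carrier leaves alone; so the
  representatives range over Z while the cosets are formed in V.\<close>

lemma subquot_simps:
  "carrier (subquot V Z B) = (\<lambda>x. B +>\<^bsub>V\<^esub> x) ` Z"
  "\<zero>\<^bsub>subquot V Z B\<^esub> = B"
  by (auto simp: subquot_def quot_space_def A_RCOSETS_def' a_r_coset_def')

lemma vectorspace_subquot:
  fixes K :: "'k ring" and V :: "('k, 'v) module"
  assumes "vectorspace K V" "subspace K U V" "subspace K W V" "W \<subseteq> U"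
  shows "vectorspace K (subquot V U W)"
proof -
  interpret V: vectorspace K V by fact
  have "quotient_space K (V\<lparr>carrier := U\<rparr>) W"
    using V.subspace_is_vs V.subspace_restrict assms(2-4)
    by (intro quotient_space.intro quotient_space_axioms.intro)
  then show ?thesis unfolding subquot_def by (rule quotient_space.vectorspace_quot_space)
qed

section \<open>Structure maps and exactness in single bidegrees\<close>

context exact_couple
begin

lemmas i_closed = mod_hom.f_im[OF linear_map.axioms(3)[OF i_linear]]
  and j_closed = mod_hom.f_im[OF linear_map.axioms(3)[OF j_linear]]
  and j_minus = mod_hom.f_minus[OF linear_map.axioms(3)[OF j_linear]]
  and k_minus = mod_hom.f_minus[OF linear_map.axioms(3)[OF k_linear]]
  and i_zero = mod_hom.f0_is_0[OF linear_map.axioms(3)[OF i_linear]]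
  and j_zero = mod_hom.f0_is_0[OF linear_map.axioms(3)[OF j_linear]]
  and k_zero = mod_hom.f0_is_0[OF linear_map.axioms(3)[OF k_linear]]

lemma ipow_linear:
  "linear_map K (Dsp X p q) (Dsp X (p + int r) (q - int r)) (ipow X r p q)"
proof (induction r)
  case 0
  then show ?case by (intro linear_mapI) (auto intro: D_vectorspace)
next
  case (Suc r)
  note lin = linear_map.axioms(3)[OF Suc] linear_map.axioms(3)[OF i_linear[of "p + int r" "q - int r"]]
  note closed = mod_hom.f_im[OF lin(1)] mod_hom.f_im[OF lin(2)]
  have eq: "p + int (Suc r) = p + int r + 1" "q - int (Suc r) = q - int r - 1" by auto
  show ?case unfolding eq
    by (intro linear_mapI D_vectorspace)
      (simp_all add: closed module_hom_add[OF mod_hom.f_hom[OF lin(1)]]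
        module_hom_add[OF mod_hom.f_hom[OF lin(2)]] module_hom_smult[OF mod_hom.f_hom[OF lin(1)]]
        module_hom_smult[OF mod_hom.f_hom[OF lin(2)]])
qed

text \<open>Indexed by the target: (p - 1, q) is the bidegree of \<open>k \<alpha>\<close> for alpha
  in bidegree (p, q).\<close>

lemma ipow_linear':
  "linear_map K (Dsp X (p - 1 - int r) (q + int r)) (Dsp X (p - 1) q)
     (ipow X r (p - 1 - int r) (q + int r))"
  using ipow_linear[of "p - 1 - int r" "q + int r" r] by simp

lemmas ipow_closed' = mod_hom.f_im[OF linear_map.axioms(3)[OF ipow_linear']]
  and ipow_minus' = mod_hom.f_minus[OF linear_map.axioms(3)[OF ipow_linear']]
  and ipow_zero' = mod_hom.f0_is_0[OF linear_map.axioms(3)[OF ipow_linear']]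

text \<open>The recursion of \<open>ipow\<close> splits off the last factor. Comparing Z^(r+1) with
  Z^r needs the first factor split off.\<close>

lemma ipow_Suc_right: "ipow X (Suc r) p q x = ipow X r (p + 1) (q - 1) (imap X p q x)"
proof (induction r)
  case (Suc r)
  have eq: "p + int (Suc r) = p + 1 + int r" "q - int (Suc r) = q - 1 - int r" by auto
  show ?case unfolding ipow.simps(2)[of X "Suc r" p] Suc eq by simp
qed simp

text \<open>\<open>exact_ki\<close> with indices shifted so that the element of D sits in bidegree
  (p, q).\<close>

lemma ker_iD:
  assumes "x \<in> carrier (Dsp X p q)" "imap X p q x = \<zero>\<^bsub>Dsp X (p + 1) (q - 1)\<^esub>"
  obtains \<alpha> where "\<alpha> \<in> carrier (Esp X (p + 1) q)" "kmap X (p + 1) q \<alpha> = x"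
proof -
  have "ker_of (Dsp X p q) (Dsp X (p + 1) (q - 1)) (imap X p q) = kmap X (p + 1) q ` carrier (Esp X (p + 1) q)"
    using exact_ki[of "p + 1" q] by simp
  moreover have "x \<in> ker_of (Dsp X p q) (Dsp X (p + 1) (q - 1)) (imap X p q)"
    using assms by (simp add: ker_of_def)
  ultimately show thesis using that by (metis imageE)
qed

lemma ker_jD:
  assumes "x \<in> carrier (Dsp X p q)" "jmap X p q x = \<zero>\<^bsub>Esp X (p - a) (q + a)\<^esub>"
  obtains y where "y \<in> carrier (Dsp X (p - 1) (q + 1))" "imap X (p - 1) (q + 1) y = x"
proof -
  have "ker_of (Dsp X p q) (Esp X (p - a) (q + a)) (jmap X p q) = imap X (p - 1) (q + 1) ` carrier (Dsp X (p - 1) (q + 1))"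
    using exact_ij[of "p - 1" "q + 1"] by simp
  moreover have "x \<in> ker_of (Dsp X p q) (Esp X (p - a) (q + a)) (jmap X p q)"
    using assms by (simp add: ker_of_def)
  ultimately show thesis using that by (metis imageE)
qed

lemma i_k: "\<alpha> \<in> carrier (Esp X p q) \<Longrightarrow> imap X (p - 1) q (kmap X p q \<alpha>) = \<zero>\<^bsub>Dsp X p (q - 1)\<^esub>"
  using exact_ki[of p q] by (auto simp: ker_of_def)

lemma j_i: "y \<in> carrier (Dsp X (p - 1) (q + 1)) \<Longrightarrow>
    jmap X p q (imap X (p - 1) (q + 1) y) = \<zero>\<^bsub>Esp X (p - a) (q + a)\<^esub>"
  using exact_ij[of "p - 1" "q + 1"] by (auto simp: ker_of_def)

lemma k_j: "x \<in> carrier (Dsp X p q) \<Longrightarrow>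
    kmap X (p - a) (q + a) (jmap X p q x) = \<zero>\<^bsub>Dsp X (p - a - 1) (q + a)\<^esub>"
  using exact_jk[of p q] by (auto simp: ker_of_def)

text \<open>Here (p, q) is the bidegree of x, the source of j, whereas \<open>Bsub\<close> is
  indexed by the target of j.\<close>

lemma mem_Bsub_iff:
  "b \<in> Bsub a X r (p - a) (q + a) \<longleftrightarrow> (\<exists>x\<in>carrier (Dsp X p q).
     ipow X r p q x = \<zero>\<^bsub>Dsp X (p + int r) (q - int r)\<^esub> \<and> b = jmap X p q x)"
  by (auto simp: Bsub_def ker_of_def)

section \<open>The subspaces B and Z and their inclusions\<close>

lemma Bsub_subspace: "subspace K (Bsub a X r p q) (Esp X p q)"
proof -
  have "linear_map K (Dsp X (p + a) (q - a)) (Esp X p q) (jmap X (p + a) (q - a))"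
    using j_linear[of "p + a" "q - a"] by simp
  then show ?thesis
    unfolding Bsub_def by (rule linear_map_image_subspace) (rule ker_of_subspace[OF ipow_linear])
qed

lemma Zsub_subspace: "subspace K (Zsub X r p q) (Esp X p q)"
  unfolding Zsub_def
  by (rule linear_map_vimage_subspace[OF k_linear linear_map_image_subspace[OF ipow_linear'
        vectorspace.carrier_subspace[OF D_vectorspace]]])

lemma Bsub_mono: "Bsub a X r p q \<subseteq> Bsub a X (Suc r) p q"
proof
  fix b assume "b \<in> Bsub a X r p q"
  then obtain x where x: "x \<in> carrier (Dsp X (p + a) (q - a))" "b = jmap X (p + a) (q - a) x"
    "ipow X r (p + a) (q - a) x = \<zero>\<^bsub>Dsp X (p + a + int r) (q - a - int r)\<^esub>"
    by (auto simp: Bsub_def ker_of_def)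
  have eq: "p + a + int (Suc r) = p + a + int r + 1" "q - a - int (Suc r) = q - a - int r - 1"
    by auto
  have "ipow X (Suc r) (p + a) (q - a) x = \<zero>\<^bsub>Dsp X (p + a + int (Suc r)) (q - a - int (Suc r))\<^esub>"
    unfolding eq by (simp add: x(3) i_zero)
  with x show "b \<in> Bsub a X (Suc r) p q" unfolding Bsub_def ker_of_def by blast
qed

text \<open>Isolates the first application of i: membership in Z^(r+1) means k alpha = i^r x for
  some x in im i, and im i = ker j. This is the form that the comparison with \<open>dbar\<close>
  uses.\<close>

lemma mem_Zsub_Suc_iff:
  "\<alpha> \<in> Zsub X (Suc r) p q \<longleftrightarrow> \<alpha> \<in> carrier (Esp X p q) \<and>
     (\<exists>y\<in>carrier (Dsp X (p - 1 - int r - 1) (q + int r + 1)).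
        kmap X p q \<alpha> = ipow X r (p - 1 - int r) (q + int r) (imap X (p - 1 - int r - 1) (q + int r + 1) y))"
proof -
  have eq: "p - 1 - int (Suc r) = p - 1 - int r - 1" "q + int (Suc r) = q + int r + 1"
    "p - 1 - int r - 1 + 1 = p - 1 - int r" "q + int r + 1 - 1 = q + int r" by auto
  show ?thesis
    unfolding Zsub_def eq(1,2) ipow_Suc_right eq(3,4) by blast
qed

lemma i_closed_left:
  "y \<in> carrier (Dsp X (p - 1) (q + 1)) \<Longrightarrow> imap X (p - 1) (q + 1) y \<in> carrier (Dsp X p q)"
  using i_closed[of y "p - 1" "q + 1"] by (simp only: diff_add_cancel add_diff_cancel_right')

lemma Zsub_mono: "Zsub X (Suc r) p q \<subseteq> Zsub X r p q"
proof
  fix \<alpha> assume "\<alpha> \<in> Zsub X (Suc r) p q"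
  then show "\<alpha> \<in> Zsub X r p q"
    using i_closed_left unfolding mem_Zsub_Suc_iff unfolding Zsub_def by blast
qed

text \<open>As k j = 0, every element of B is sent by k to zero, which lies in the image of every
  power of i; hence r and s are independent.\<close>

lemma Bsub_subset_Zsub: "Bsub a X r p q \<subseteq> Zsub X s p q"
proof
  fix b assume "b \<in> Bsub a X r p q"
  then obtain x where x: "x \<in> carrier (Dsp X (p + a) (q - a))" "b = jmap X (p + a) (q - a) x"
    by (auto simp: Bsub_def ker_of_def)
  have "b \<in> carrier (Esp X p q)" using j_closed[OF x(1)] x(2) by simp
  moreover have "kmap X p q b = ipow X s (p - 1 - int s) (q + int s) \<zero>\<^bsub>Dsp X (p - 1 - int s) (q + int s)\<^esub>"
    using k_j[OF x(1)] x(2) ipow_zero'[of s p q] by simp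
  moreover have "\<zero>\<^bsub>Dsp X (p - 1 - int s) (q + int s)\<^esub> \<in> carrier (Dsp X (p - 1 - int s) (q + int s))"
    using vectorspace.subspaceD(2)[OF D_vectorspace vectorspace.carrier_subspace[OF D_vectorspace]] .
  ultimately show "b \<in> Zsub X s p q" unfolding Zsub_def by blast
qed

lemma abelian_groups: "abelian_group (Dsp X p q)" "abelian_group (Esp X p q)"
  using D_vectorspace[of p q] E_vectorspace[of p q]
  by (auto simp: vectorspace_def module_def)

lemma minus_closed:
  "x \<in> carrier (Dsp X p q) \<Longrightarrow> y \<in> carrier (Dsp X p q) \<Longrightarrow> x \<ominus>\<^bsub>Dsp X p q\<^esub> y \<in> carrier (Dsp X p q)"
  "u \<in> carrier (Esp X p q) \<Longrightarrow> v \<in> carrier (Esp X p q) \<Longrightarrow> u \<ominus>\<^bsub>Esp X p q\<^esub> v \<in> carrier (Esp X p q)"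
  using abelian_groups[of p q] by (simp_all add: abelian_group.minus_closed)

lemma minus_self:
  "x \<in> carrier (Dsp X p q) \<Longrightarrow> x \<ominus>\<^bsub>Dsp X p q\<^esub> x = \<zero>\<^bsub>Dsp X p q\<^esub>"
  "u \<in> carrier (Esp X p q) \<Longrightarrow> u \<ominus>\<^bsub>Esp X p q\<^esub> u = \<zero>\<^bsub>Esp X p q\<^esub>"
  using abelian_groups[of p q] by (simp_all add: a_minus_def abelian_group.r_neg)

lemma minus_zero_right:
  "u \<in> carrier (Esp X p q) \<Longrightarrow> u \<ominus>\<^bsub>Esp X p q\<^esub> \<zero>\<^bsub>Esp X p q\<^esub> = u"
  "x \<in> carrier (Dsp X p q) \<Longrightarrow> x \<ominus>\<^bsub>Dsp X p q\<^esub> \<zero>\<^bsub>Dsp X p q\<^esub> = x"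
proof -
  interpret E: abelian_group "Esp X p q" by (rule abelian_groups)
  interpret D: abelian_group "Dsp X p q" by (rule abelian_groups)
  have "\<ominus>\<^bsub>Esp X p q\<^esub> \<zero>\<^bsub>Esp X p q\<^esub> = \<zero>\<^bsub>Esp X p q\<^esub>" by (rule E.minus_equality) auto
  moreover have "\<ominus>\<^bsub>Dsp X p q\<^esub> \<zero>\<^bsub>Dsp X p q\<^esub> = \<zero>\<^bsub>Dsp X p q\<^esub>" by (rule D.minus_equality) auto
  ultimately show "u \<in> carrier (Esp X p q) \<Longrightarrow> u \<ominus>\<^bsub>Esp X p q\<^esub> \<zero>\<^bsub>Esp X p q\<^esub> = u"
    "x \<in> carrier (Dsp X p q) \<Longrightarrow> x \<ominus>\<^bsub>Dsp X p q\<^esub> \<zero>\<^bsub>Dsp X p q\<^esub> = x"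
    by (simp_all add: a_minus_def)
qed

lemma zero_closed: "\<zero>\<^bsub>Dsp X p q\<^esub> \<in> carrier (Dsp X p q)" "\<zero>\<^bsub>Esp X p q\<^esub> \<in> carrier (Esp X p q)"
  using abelian_groups[of p q] by (auto simp: abelian_group_def abelian_monoid.zero_closed)

lemma quotient_Z: "quotient_space K (Esp X p q) (Zsub X r p q)"
  by (intro quotient_space.intro quotient_space_axioms.intro E_vectorspace Zsub_subspace)

lemma quotient_B: "quotient_space K (Esp X p q) (Bsub a X r p q)"
  by (intro quotient_space.intro quotient_space_axioms.intro E_vectorspace Bsub_subspace)

lemmas Z_coset_eq_iff = quotient_space.coset_eq_iff[OF quotient_Z]
  and B_coset_eq_iff = quotient_space.coset_eq_iff[OF quotient_B]
  and Z_coset_eq_self_iff = quotient_space.coset_eq_self_iff[OF quotient_Z]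
  and B_coset_eq_self_iff = quotient_space.coset_eq_self_iff[OF quotient_B]

section \<open>The map \<open>dbar\<close> and its bijectivity\<close>

context
  fixes r :: nat and p q P Q :: int
  assumes PQ: "P = p - 1 - int r" "Q = q + int r"
begin

text \<open>(P, Q) is the bidegree of x in k alpha = i^r x for alpha in bidegree (p, q), so j x lies
  in bidegree (P - a, Q + a). Keeping P and Q as variables tied by equations spares the terms any
  rearrangement of integers.\<close>

lemma ipow_PQ:
  "x \<in> carrier (Dsp X P Q) \<Longrightarrow> ipow X r P Q x \<in> carrier (Dsp X (p - 1) q)"
  "x \<in> carrier (Dsp X P Q) \<Longrightarrow> y \<in> carrier (Dsp X P Q) \<Longrightarrow>
    ipow X r P Q (x \<ominus>\<^bsub>Dsp X P Q\<^esub> y) = ipow X r P Q x \<ominus>\<^bsub>Dsp X (p - 1) q\<^esub> ipow X r P Q y"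
  "ipow X r P Q \<zero>\<^bsub>Dsp X P Q\<^esub> = \<zero>\<^bsub>Dsp X (p - 1) q\<^esub>"
  unfolding PQ using ipow_zero' by (auto simp: ipow_closed' ipow_minus')

lemma mem_Bsub_PQ:
  "b \<in> Bsub a X r (P - a) (Q + a) \<longleftrightarrow>
    (\<exists>x\<in>carrier (Dsp X P Q). ipow X r P Q x = \<zero>\<^bsub>Dsp X (p - 1) q\<^esub> \<and> b = jmap X P Q x)"
proof -
  have "P + int r = p - 1" "Q - int r = q" by (auto simp: PQ)
  then show ?thesis using mem_Bsub_iff[of b r P Q] by simp
qed

text \<open>Here the last application of i is isolated: i^r x lies in ker i = im k, which is where
  alpha comes from in \<open>dbar_surj\<close>.\<close>

lemma mem_Bsub_Suc_PQ:
  "b \<in> Bsub a X (Suc r) (P - a) (Q + a) \<longleftrightarrow>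
    (\<exists>x\<in>carrier (Dsp X P Q). imap X (p - 1) q (ipow X r P Q x) = \<zero>\<^bsub>Dsp X p (q - 1)\<^esub> \<and> b = jmap X P Q x)"
proof -
  have "P + int r = p - 1" "Q - int r = q" "P + int (Suc r) = p" "Q - int (Suc r) = q - 1"
    by (auto simp: PQ)
  note eq = this
  show ?thesis unfolding mem_Bsub_iff ipow.simps(2) eq ..
qed

lemma mem_Zsub_PQ:
  "\<alpha> \<in> Zsub X r p q \<longleftrightarrow>
    \<alpha> \<in> carrier (Esp X p q) \<and> (\<exists>x\<in>carrier (Dsp X P Q). kmap X p q \<alpha> = ipow X r P Q x)"
  unfolding Zsub_def PQ by blast

lemmas mem_Zsub_Suc_PQ = mem_Zsub_Suc_iff[of _ r p q, folded PQ]

text \<open>Write k (alpha - beta) = i^r (i z). Then w = x - y - i z is killed by i^r, and j w = j x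
  - j y because j i = 0. The case alpha = beta covers the choice of x.\<close>

lemma dbar_well_defined:
  assumes \<alpha>: "\<alpha> \<in> carrier (Esp X p q)" "\<beta> \<in> carrier (Esp X p q)" "\<alpha> \<ominus>\<^bsub>Esp X p q\<^esub> \<beta> \<in> Zsub X (Suc r) p q"
    and x: "x \<in> carrier (Dsp X P Q)" "kmap X p q \<alpha> = ipow X r P Q x"
    and y: "y \<in> carrier (Dsp X P Q)" "kmap X p q \<beta> = ipow X r P Q y"
  shows "jmap X P Q x \<ominus>\<^bsub>Esp X (P - a) (Q + a)\<^esub> jmap X P Q y \<in> Bsub a X r (P - a) (Q + a)"
proof -
  obtain z where z: "z \<in> carrier (Dsp X (P - 1) (Q + 1))"
    "kmap X p q (\<alpha> \<ominus>\<^bsub>Esp X p q\<^esub> \<beta>) = ipow X r P Q (imap X (P - 1) (Q + 1) z)"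
    using \<alpha>(3) unfolding mem_Zsub_Suc_PQ by blast
  define z' where "z' = imap X (P - 1) (Q + 1) z"
  have z': "z' \<in> carrier (Dsp X P Q)" unfolding z'_def by (rule i_closed_left) fact
  define w where "w = (x \<ominus>\<^bsub>Dsp X P Q\<^esub> y) \<ominus>\<^bsub>Dsp X P Q\<^esub> z'"
  have xy: "x \<ominus>\<^bsub>Dsp X P Q\<^esub> y \<in> carrier (Dsp X P Q)" by (rule minus_closed) fact+
  have w: "w \<in> carrier (Dsp X P Q)" unfolding w_def by (rule minus_closed) fact+
  have "ipow X r P Q w = kmap X p q (\<alpha> \<ominus>\<^bsub>Esp X p q\<^esub> \<beta>) \<ominus>\<^bsub>Dsp X (p - 1) q\<^esub> ipow X r P Q z'"
    by (simp add: w_def ipow_PQ(2) xy x y z' k_minus \<alpha>)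
  also have "\<dots> = \<zero>\<^bsub>Dsp X (p - 1) q\<^esub>"
    unfolding z(2) z'_def[symmetric] by (rule minus_self) (rule ipow_PQ(1)[OF z'])
  finally have "jmap X P Q w \<in> Bsub a X r (P - a) (Q + a)"
    unfolding mem_Bsub_PQ using w by blast
  moreover have "jmap X P Q w = jmap X P Q x \<ominus>\<^bsub>Esp X (P - a) (Q + a)\<^esub> jmap X P Q y"
    using j_i[OF z(1)] by (simp add: w_def j_minus xy x y z' minus_zero_right minus_closed j_closed flip: z'_def)
  ultimately show ?thesis by simp
qed

text \<open>Evaluates the definite description: alpha and x are witnesses themselves, and
  \<open>dbar_well_defined\<close> gives uniqueness. All further properties of \<open>dbar\<close>
  are read off from this equation.\<close>

lemma dbar_eq:
  assumes \<alpha>: "\<alpha> \<in> carrier (Esp X p q)"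
    and x: "x \<in> carrier (Dsp X P Q)" "kmap X p q \<alpha> = ipow X r P Q x"
  shows "dbar a X r p q (Zsub X (Suc r) p q +>\<^bsub>Esp X p q\<^esub> \<alpha>) =
    Bsub a X r (P - a) (Q + a) +>\<^bsub>Esp X (P - a) (Q + a)\<^esub> jmap X P Q x"
  unfolding dbar_def PQ[symmetric]
proof (rule the_equality)
  show "\<exists>\<beta>\<in>Zsub X r p q. \<exists>y\<in>carrier (Dsp X P Q).
      Zsub X (Suc r) p q +>\<^bsub>Esp X p q\<^esub> \<alpha> = Zsub X (Suc r) p q +>\<^bsub>Esp X p q\<^esub> \<beta> \<and>
      kmap X p q \<beta> = ipow X r P Q y \<and>
      Bsub a X r (P - a) (Q + a) +>\<^bsub>Esp X (P - a) (Q + a)\<^esub> jmap X P Q x =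
      Bsub a X r (P - a) (Q + a) +>\<^bsub>Esp X (P - a) (Q + a)\<^esub> jmap X P Q y"
    using assms mem_Zsub_PQ[of \<alpha>] by blast
next
  fix b
  assume "\<exists>\<beta>\<in>Zsub X r p q. \<exists>y\<in>carrier (Dsp X P Q).
      Zsub X (Suc r) p q +>\<^bsub>Esp X p q\<^esub> \<alpha> = Zsub X (Suc r) p q +>\<^bsub>Esp X p q\<^esub> \<beta> \<and>
      kmap X p q \<beta> = ipow X r P Q y \<and>
      b = Bsub a X r (P - a) (Q + a) +>\<^bsub>Esp X (P - a) (Q + a)\<^esub> jmap X P Q y"
  then obtain \<beta> y where "\<beta> \<in> Zsub X r p q" and \<beta>: "y \<in> carrier (Dsp X P Q)" "kmap X p q \<beta> = ipow X r P Q y"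
    and eq: "Zsub X (Suc r) p q +>\<^bsub>Esp X p q\<^esub> \<alpha> = Zsub X (Suc r) p q +>\<^bsub>Esp X p q\<^esub> \<beta>"
    and b: "b = Bsub a X r (P - a) (Q + a) +>\<^bsub>Esp X (P - a) (Q + a)\<^esub> jmap X P Q y"
    by blast
  then have \<beta>: "\<beta> \<in> carrier (Esp X p q)" "y \<in> carrier (Dsp X P Q)" "kmap X p q \<beta> = ipow X r P Q y"
    by (auto simp: Zsub_def)
  have "\<alpha> \<ominus>\<^bsub>Esp X p q\<^esub> \<beta> \<in> Zsub X (Suc r) p q"
    using eq Z_coset_eq_iff[OF \<alpha> \<beta>(1)] by blast
  then have "jmap X P Q x \<ominus>\<^bsub>Esp X (P - a) (Q + a)\<^esub> jmap X P Q y \<in> Bsub a X r (P - a) (Q + a)"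
    by (rule dbar_well_defined[OF \<alpha> \<beta>(1) _ x \<beta>(2,3)])
  then show "b = Bsub a X r (P - a) (Q + a) +>\<^bsub>Esp X (P - a) (Q + a)\<^esub> jmap X P Q x"
    unfolding b using B_coset_eq_iff[OF j_closed[OF x(1)] j_closed[OF \<beta>(2)], of r] by metis
qed

text \<open>Stands in for linearity at zero: it makes \<open>Cdiff\<close> preserve finite support
  and makes families without \<open>ZZ\<close> components cycles.\<close>

lemma dbar_zero: "dbar a X r p q (Zsub X (Suc r) p q) = Bsub a X r (P - a) (Q + a)"
proof -
  have "\<zero>\<^bsub>Esp X p q\<^esub> \<in> Zsub X (Suc r) p q"
    by (rule vectorspace.subspaceD(2)[OF E_vectorspace Zsub_subspace])
  then have Z: "Zsub X (Suc r) p q +>\<^bsub>Esp X p q\<^esub> \<zero>\<^bsub>Esp X p q\<^esub> = Zsub X (Suc r) p q"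
    using Z_coset_eq_self_iff[OF zero_closed(2)] by blast
  have "\<zero>\<^bsub>Esp X (P - a) (Q + a)\<^esub> \<in> Bsub a X r (P - a) (Q + a)"
    by (rule vectorspace.subspaceD(2)[OF E_vectorspace Bsub_subspace])
  then have B: "Bsub a X r (P - a) (Q + a) +>\<^bsub>Esp X (P - a) (Q + a)\<^esub> \<zero>\<^bsub>Esp X (P - a) (Q + a)\<^esub> = Bsub a X r (P - a) (Q + a)"
    using B_coset_eq_self_iff[OF zero_closed(2)] by blast
  show ?thesis
    using dbar_eq[OF zero_closed(2) zero_closed(1)] by (simp add: Z B j_zero k_zero ipow_PQ(3))
qed

lemma subquot_Z_cases:
  assumes "c \<in> carrier (subquot (Esp X p q) (Zsub X r p q) (Zsub X (Suc r) p q))"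
  obtains \<alpha> x where "\<alpha> \<in> carrier (Esp X p q)" "x \<in> carrier (Dsp X P Q)" "kmap X p q \<alpha> = ipow X r P Q x"
    "c = Zsub X (Suc r) p q +>\<^bsub>Esp X p q\<^esub> \<alpha>"
  using assms by (auto simp: subquot_simps mem_Zsub_PQ)

text \<open>Since i k = 0, the element i^r x = k alpha is killed by one more i.\<close>

lemma dbar_closed:
  assumes "c \<in> carrier (subquot (Esp X p q) (Zsub X r p q) (Zsub X (Suc r) p q))"
  shows "dbar a X r p q c \<in> carrier
    (subquot (Esp X (P - a) (Q + a)) (Bsub a X (Suc r) (P - a) (Q + a)) (Bsub a X r (P - a) (Q + a)))"
proof -
  obtain \<alpha> x where \<alpha>: "\<alpha> \<in> carrier (Esp X p q)" and x: "x \<in> carrier (Dsp X P Q)" "kmap X p q \<alpha> = ipow X r P Q x"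
    and c: "c = Zsub X (Suc r) p q +>\<^bsub>Esp X p q\<^esub> \<alpha>"
    by (rule subquot_Z_cases[OF assms(1)])
  have "imap X (p - 1) q (ipow X r P Q x) = \<zero>\<^bsub>Dsp X p (q - 1)\<^esub>"
    using i_k[OF \<alpha>] x(2) by simp
  then have "jmap X P Q x \<in> Bsub a X (Suc r) (P - a) (Q + a)"
    unfolding mem_Bsub_Suc_PQ using x(1) by blast
  then show ?thesis
    unfolding c dbar_eq[OF \<alpha> x] subquot_simps by (rule imageI)
qed

text \<open>If j x = j w with i^r w = 0, then v = x - w lies in ker j = im i and still satisfies i^r
  v = k alpha; so alpha belongs to Z^(r+1).\<close>

lemma dbar_inj:
  assumes "c \<in> carrier (subquot (Esp X p q) (Zsub X r p q) (Zsub X (Suc r) p q))"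
    and "dbar a X r p q c = Bsub a X r (P - a) (Q + a)"
  shows "c = Zsub X (Suc r) p q"
proof -
  obtain \<alpha> x where \<alpha>: "\<alpha> \<in> carrier (Esp X p q)" and x: "x \<in> carrier (Dsp X P Q)" "kmap X p q \<alpha> = ipow X r P Q x"
    and c: "c = Zsub X (Suc r) p q +>\<^bsub>Esp X p q\<^esub> \<alpha>"
    by (rule subquot_Z_cases[OF assms(1)])
  have "jmap X P Q x \<in> Bsub a X r (P - a) (Q + a)"
    using assms(2) B_coset_eq_self_iff[OF j_closed[OF x(1)]] unfolding c dbar_eq[OF \<alpha> x] by blast
  then obtain w where w: "w \<in> carrier (Dsp X P Q)" "ipow X r P Q w = \<zero>\<^bsub>Dsp X (p - 1) q\<^esub>" "jmap X P Q x = jmap X P Q w"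
    unfolding mem_Bsub_PQ by blast
  define v where "v = x \<ominus>\<^bsub>Dsp X P Q\<^esub> w"
  have v: "v \<in> carrier (Dsp X P Q)" unfolding v_def by (rule minus_closed) fact+
  have "jmap X P Q v = \<zero>\<^bsub>Esp X (P - a) (Q + a)\<^esub>"
    by (simp add: v_def j_minus x(1) w minus_self j_closed)
  then obtain y where y: "y \<in> carrier (Dsp X (P - 1) (Q + 1))" "imap X (P - 1) (Q + 1) y = v"
    using ker_jD[OF v] by blast
  have "kmap X p q \<alpha> = ipow X r P Q v"
    by (simp add: v_def ipow_PQ(2) x w minus_zero_right ipow_PQ(1))
  then have "\<alpha> \<in> Zsub X (Suc r) p q" unfolding mem_Zsub_Suc_PQ using y \<alpha> by blast
  then show ?thesis using Z_coset_eq_self_iff[OF \<alpha>] c by blast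
qed

text \<open>A class in B^(r+1) is represented by j x with i^r x in ker i = im k; any preimage of i^r
  x under k maps to it.\<close>

lemma dbar_surj:
  assumes "b \<in> carrier
    (subquot (Esp X (P - a) (Q + a)) (Bsub a X (Suc r) (P - a) (Q + a)) (Bsub a X r (P - a) (Q + a)))"
  shows "\<exists>c\<in>carrier (subquot (Esp X p q) (Zsub X r p q) (Zsub X (Suc r) p q)). dbar a X r p q c = b"
proof -
  obtain x where x: "x \<in> carrier (Dsp X P Q)" "imap X (p - 1) q (ipow X r P Q x) = \<zero>\<^bsub>Dsp X p (q - 1)\<^esub>"
    and b: "b = Bsub a X r (P - a) (Q + a) +>\<^bsub>Esp X (P - a) (Q + a)\<^esub> jmap X P Q x"
    using assms by (auto simp: subquot_simps mem_Bsub_Suc_PQ)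
  obtain \<alpha> where \<alpha>: "\<alpha> \<in> carrier (Esp X p q)" "kmap X p q \<alpha> = ipow X r P Q x"
    using ker_iD[OF ipow_PQ(1)[OF x(1)]] x(2) by auto
  then have "\<alpha> \<in> Zsub X r p q" unfolding mem_Zsub_PQ using x(1) by blast
  then have "Zsub X (Suc r) p q +>\<^bsub>Esp X p q\<^esub> \<alpha> \<in> carrier (subquot (Esp X p q) (Zsub X r p q) (Zsub X (Suc r) p q))"
    unfolding subquot_simps by (rule imageI)
  then show ?thesis using dbar_eq[OF \<alpha>(1) x(1) \<alpha>(2)] b by blast
qed

end
end

section \<open>Homology of the associated complex\<close>

text \<open>Shows that the cycles form a subspace once \<open>ker_Cdiff\<close> has described them
  by vanishing coordinates.\<close>

lemma dsum_vanishing_subspace: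
  assumes "field K" and M: "\<And>i. i \<in> I \<Longrightarrow> vectorspace K (M i)" and "J \<subseteq> I"
  shows "subspace K {f \<in> carrier (dsum I M). \<forall>j\<in>J. f j = \<zero>\<^bsub>M j\<^esub>} (dsum I M)"
proof -
  note mo = vectorspace.axioms(1)[OF M]
  note smult_zero = module.smult_r_null[OF mo]
  interpret vectorspace K "dsum I M" by (rule vectorspace_dsum[OF assms(1) M])
  have am: "abelian_monoid (M i)" if "i \<in> I" for i
    using module.axioms(2)[OF mo[OF that]] by (rule abelian_group.axioms)
  have z: "\<zero>\<^bsub>M i\<^esub> \<in> carrier (M i)" "\<zero>\<^bsub>M i\<^esub> \<oplus>\<^bsub>M i\<^esub> \<zero>\<^bsub>M i\<^esub> = \<zero>\<^bsub>M i\<^esub>" if "i \<in> I" for i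
    using am[OF that] by (simp_all add: abelian_monoid.zero_closed abelian_monoid.l_zero)
  show ?thesis
  proof (rule subspaceI)
    fix f g assume "f \<in> {f \<in> carrier (dsum I M). \<forall>j\<in>J. f j = \<zero>\<^bsub>M j\<^esub>}" "g \<in> {f \<in> carrier (dsum I M). \<forall>j\<in>J. f j = \<zero>\<^bsub>M j\<^esub>}"
    moreover from this have "f \<oplus>\<^bsub>dsum I M\<^esub> g \<in> carrier (dsum I M)" by simp
    ultimately show "f \<oplus>\<^bsub>dsum I M\<^esub> g \<in> {f \<in> carrier (dsum I M). \<forall>j\<in>J. f j = \<zero>\<^bsub>M j\<^esub>}"
      using z \<open>J \<subseteq> I\<close> by (auto simp: dsum_ops(2))
  next
    fix c f assume c: "c \<in> carrier K" and "f \<in> {f \<in> carrier (dsum I M). \<forall>j\<in>J. f j = \<zero>\<^bsub>M j\<^esub>}"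
    moreover from this have "c \<odot>\<^bsub>dsum I M\<^esub> f \<in> carrier (dsum I M)" by simp
    ultimately show "c \<odot>\<^bsub>dsum I M\<^esub> f \<in> {f \<in> carrier (dsum I M). \<forall>j\<in>J. f j = \<zero>\<^bsub>M j\<^esub>}"
      using smult_zero[OF _ c] \<open>J \<subseteq> I\<close> by (auto simp: dsum_ops(3))
  next
    have "\<zero>\<^bsub>dsum I M\<^esub> \<in> carrier (dsum I M)" by simp
    then show "\<zero>\<^bsub>dsum I M\<^esub> \<in> {f \<in> carrier (dsum I M). \<forall>j\<in>J. f j = \<zero>\<^bsub>M j\<^esub>}"
      using \<open>J \<subseteq> I\<close> by (auto simp: dsum_ops(1))
  qed auto
qed

lemma mem_parts_iff:
  "(p, q, ZB) \<in> parts N l \<longleftrightarrow> p + q = l"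
  "(p, q, BB r) \<in> parts N l \<longleftrightarrow> p + q = l \<and> r < N"
  "(p, q, ZZ r) \<in> parts N l \<longleftrightarrow> p + q = l \<and> r < N"
  by (auto simp: parts_def)

lemma Cdiff_simps:
  "p + q = l - 1 \<Longrightarrow> r < N \<Longrightarrow> Cdiff a X N l f (p, q, BB r) =
     dbar a X r (p + a + int r + 1) (q - a - int r) (f (p + a + int r + 1, q - a - int r, ZZ r))"
  "p + q = l - 1 \<Longrightarrow> Cdiff a X N l f (p, q, ZB) = \<zero>\<^bsub>part_space a X N (p, q, ZB)\<^esub>"
  "p + q = l - 1 \<Longrightarrow> r < N \<Longrightarrow> Cdiff a X N l f (p, q, ZZ r) = \<zero>\<^bsub>part_space a X N (p, q, ZZ r)\<^esub>"
  "Cdiff a X N l f \<in> extensional (parts N (l - 1))"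
  by (simp_all add: Cdiff_def mem_parts_iff)

text \<open>\<open>stable_from\<close> compares consecutive indices only; induction on the distance
  from N shows that all later pages equal page N as records.\<close>

lemma E_infty_stable:
  assumes "stable_from a X N"
  shows "E_infty a X p q = page a X N p q"
proof -
  have "Bsub a X (N + n) p q = Bsub a X N p q \<and> Zsub X (N + n) p q = Zsub X N p q" for n
  proof (induction n)
    case (Suc n)
    have "Bsub a X (N + n) p q = Bsub a X (Suc (N + n)) p q \<and> Zsub X (N + n) p q = Zsub X (Suc (N + n)) p q"
      using assms unfolding stable_from_def by (meson le_add1)
    with Suc show ?case by (metis add_Suc_right)
  qed simp
  then have ev: "\<forall>\<^sub>F r in sequentially. page a X r p q = page a X N p q"
    unfolding eventually_sequentially page_def by (metis le_iff_add)
  show ?thesis unfolding E_infty_def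
  proof (rule the_equality, rule ev)
    fix V assume "\<forall>\<^sub>F r in sequentially. page a X r p q = V"
    \<comment> \<open>Two eventual values agree at a common index, and a constant statement that
      holds eventually along \<open>sequentially\<close> is true.\<close>
    with ev have "\<forall>\<^sub>F r in sequentially. V = page a X N p q" by eventually_elim auto
    then show "V = page a X N p q" by simp
  qed
qed

text \<open>Describes the graded pieces at the positions where the filtration does not jump.\<close>

lemma carrier_subquot_self:
  fixes K :: "'k ring" and V :: "('k, 'v) module"
  assumes "subspace K W V"
  shows "carrier (subquot V W W) = {W}"
proof -
  interpret quotient_space K V W
    using assms subspace.vs[OF assms] by (intro quotient_space.intro quotient_space_axioms.intro)
  have "W +>\<^bsub>V\<^esub> w = W" if "w \<in> W" for w
    using coset_eq_self_iff[of w] that subspaceD(1)[OF assms] by blast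
  then show ?thesis using subspaceD(2)[OF assms] by (auto simp: subquot_simps)
qed

section \<open>Cycles and boundaries of the associated complex\<close>

context exact_couple
begin

lemma field_K: "field K"
  using D_vectorspace[of 0 0] by (rule vectorspace.axioms)

lemma vectorspace_part_space: "vectorspace K (part_space a X N i)"
proof -
  obtain p q s where i: "i = (p, q, s)" by (cases i)
  show ?thesis
    unfolding i by (cases s)
      (auto intro!: vectorspace_subquot E_vectorspace Bsub_subspace Zsub_subspace Bsub_mono Zsub_mono
        Bsub_subset_Zsub)
qed

lemma zero_part_space: "\<zero>\<^bsub>part_space a X N i\<^esub> \<in> carrier (part_space a X N i)"
proof -
  interpret vectorspace K "part_space a X N i" by (rule vectorspace_part_space)
  show ?thesis by simp
qed

lemma vectorspace_Cplx: "vectorspace K (Cplx a X N l)"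
  unfolding Cplx_def by (intro vectorspace_dsum field_K vectorspace_part_space)

text \<open>The facts on \<open>dbar\<close> indexed by the target bidegree (p, q), as
  \<open>Cdiff\<close> uses them; here P = p + a and Q = q - a.\<close>

lemma dbar_part_space:
  fixes p q :: int and r :: nat
  defines "p' \<equiv> p + a + int r + 1" and "q' \<equiv> q - a - int r"
  shows "dbar a X r p' q' \<zero>\<^bsub>part_space a X N (p', q', ZZ r)\<^esub> = \<zero>\<^bsub>part_space a X N (p, q, BB r)\<^esub>"
    and "c \<in> carrier (part_space a X N (p', q', ZZ r)) \<Longrightarrow>
      dbar a X r p' q' c \<in> carrier (part_space a X N (p, q, BB r))"
    and "c \<in> carrier (part_space a X N (p', q', ZZ r)) \<Longrightarrow>
      dbar a X r p' q' c = \<zero>\<^bsub>part_space a X N (p, q, BB r)\<^esub> \<Longrightarrow> c = \<zero>\<^bsub>part_space a X N (p', q', ZZ r)\<^esub>"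
    and "b \<in> carrier (part_space a X N (p, q, BB r)) \<Longrightarrow>
      \<exists>c\<in>carrier (part_space a X N (p', q', ZZ r)). dbar a X r p' q' c = b"
proof -
  have PQ: "p + a = p' - 1 - int r" "q - a = q' + int r" by (auto simp: p'_def q'_def)
  note facts = dbar_zero[OF PQ] dbar_closed[OF PQ] dbar_inj[OF PQ] dbar_surj[OF PQ]
  have eq: "p + a - a = p" "q - a + a = q" by auto
  note facts = facts[unfolded eq]
  show "dbar a X r p' q' \<zero>\<^bsub>part_space a X N (p', q', ZZ r)\<^esub> = \<zero>\<^bsub>part_space a X N (p, q, BB r)\<^esub>"
    using facts(1) by (simp add: subquot_simps(2))
  show "c \<in> carrier (part_space a X N (p', q', ZZ r)) \<Longrightarrow>
      dbar a X r p' q' c \<in> carrier (part_space a X N (p, q, BB r))"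
    using facts(2)[of c] by simp
  show "c \<in> carrier (part_space a X N (p', q', ZZ r)) \<Longrightarrow>
      dbar a X r p' q' c = \<zero>\<^bsub>part_space a X N (p, q, BB r)\<^esub> \<Longrightarrow> c = \<zero>\<^bsub>part_space a X N (p', q', ZZ r)\<^esub>"
    using facts(3)[of c] by (simp add: subquot_simps(2))
  show "b \<in> carrier (part_space a X N (p, q, BB r)) \<Longrightarrow>
      \<exists>c\<in>carrier (part_space a X N (p', q', ZZ r)). dbar a X r p' q' c = b"
    using facts(4)[of b] by simp
qed

text \<open>Every \<open>ZZ\<close> component of f is read by exactly one \<open>BB\<close>
  component of \<open>Cdiff a X N l f\<close>, so the equations for a cycle decouple and
  \<open>dbar\<close> having trivial kernel solves each of them.\<close>

lemma ker_Cdiff: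
  "ker_of (Cplx a X N l) (Cplx a X N (l - 1)) (Cdiff a X N l) =
     {f \<in> carrier (Cplx a X N l). \<forall>i\<in>parts N l \<inter> {(p, q, ZZ r) | p q r. True}. f i = \<zero>\<^bsub>part_space a X N i\<^esub>}"
proof (intro equalityI subsetI)
  fix f assume "f \<in> ker_of (Cplx a X N l) (Cplx a X N (l - 1)) (Cdiff a X N l)"
  then have f: "f \<in> carrier (Cplx a X N l)" and 0: "Cdiff a X N l f = \<zero>\<^bsub>Cplx a X N (l - 1)\<^esub>"
    by (auto simp: ker_of_def)
  have "f (p, q, ZZ r) = \<zero>\<^bsub>part_space a X N (p, q, ZZ r)\<^esub>" if "(p, q, ZZ r) \<in> parts N l" for p q r
  proof -
    \<comment> \<open>Inverts the shift in \<open>Cdiff\<close>: at (p', q') the \<open>BB r\<close>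
      component is computed from the \<open>ZZ r\<close> component at (p, q).\<close>
    define p' q' where "p' = p - a - int r - 1" and "q' = q + a + int r"
    have pq: "p = p' + a + int r + 1" "q = q' - a - int r" by (auto simp: p'_def q'_def)
    have mem: "p' + q' = l - 1" "r < N" using that by (auto simp: mem_parts_iff p'_def q'_def)
    have "Cdiff a X N l f (p', q', BB r) = \<zero>\<^bsub>part_space a X N (p', q', BB r)\<^esub>"
      unfolding 0 using mem by (simp add: Cplx_def dsum_ops mem_parts_iff)
    then have "dbar a X r p q (f (p, q, ZZ r)) = \<zero>\<^bsub>part_space a X N (p', q', BB r)\<^esub>"
      unfolding Cdiff_simps(1)[OF mem] pq .
    moreover have "f (p, q, ZZ r) \<in> carrier (part_space a X N (p, q, ZZ r))"
      using f that unfolding Cplx_def mem_dsum_iff by blast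
    ultimately show ?thesis unfolding pq using dbar_part_space(3) by blast
  qed
  with f show "f \<in> {f \<in> carrier (Cplx a X N l). \<forall>i\<in>parts N l \<inter> {(p, q, ZZ r) | p q r. True}. f i = \<zero>\<^bsub>part_space a X N i\<^esub>}"
    by blast
next
  fix f assume "f \<in> {f \<in> carrier (Cplx a X N l). \<forall>i\<in>parts N l \<inter> {(p, q, ZZ r) | p q r. True}. f i = \<zero>\<^bsub>part_space a X N i\<^esub>}"
  then have f: "f \<in> carrier (Cplx a X N l)"
    and 0: "\<And>p q r. (p, q, ZZ r) \<in> parts N l \<Longrightarrow> f (p, q, ZZ r) = \<zero>\<^bsub>part_space a X N (p, q, ZZ r)\<^esub>"
    by blast+
  have "Cdiff a X N l f i = \<zero>\<^bsub>part_space a X N i\<^esub>" if i: "i \<in> parts N (l - 1)" for i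
  proof -
    obtain p q s where "i = (p, q, s)" by (cases i)
    show ?thesis
    proof (cases s)
      case (BB r)
      then have "p + q = l - 1" "r < N" using i by (auto simp: mem_parts_iff \<open>i = _\<close>)
      moreover from this have "(p + a + int r + 1, q - a - int r, ZZ r) \<in> parts N l"
        by (auto simp: mem_parts_iff)
      ultimately show ?thesis
        unfolding \<open>i = _\<close> BB by (simp only: Cdiff_simps 0 dbar_part_space(1))
    qed (use i in \<open>auto simp: mem_parts_iff Cdiff_simps \<open>i = _\<close>\<close>)
  qed
  then have "Cdiff a X N l f = \<zero>\<^bsub>Cplx a X N (l - 1)\<^esub>"
    unfolding Cplx_def dsum_ops by (intro extensionalityI[OF Cdiff_simps(4)]) auto
  with f show "f \<in> ker_of (Cplx a X N l) (Cplx a X N (l - 1)) (Cdiff a X N l)"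
    by (simp add: ker_of_def)
qed

text \<open>A family on the \<open>BB\<close> summands is lifted component by component, as
  \<open>dbar\<close> is onto. In both inclusions finite support is carried along the bijection
  between the \<open>BB\<close> indices of degree l and the \<open>ZZ\<close> indices of degree l +
  1.\<close>

lemma im_Cdiff:
  "Cdiff a X N (l + 1) ` carrier (Cplx a X N (l + 1)) =
     {f \<in> carrier (Cplx a X N l). \<forall>(p, q, s)\<in>parts N l. (\<forall>r. s \<noteq> BB r) \<longrightarrow> f (p, q, s) = \<zero>\<^bsub>part_space a X N (p, q, s)\<^esub>}"
  (is "_ = ?R")
proof (intro equalityI subsetI)
  fix f assume "f \<in> Cdiff a X N (l + 1) ` carrier (Cplx a X N (l + 1))"
  then obtain g where g: "g \<in> carrier (Cplx a X N (l + 1))" and f: "f = Cdiff a X N (l + 1) g"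
    by blast
  have f_zero: "f (p, q, s) = \<zero>\<^bsub>part_space a X N (p, q, s)\<^esub>"
    if "(p, q, s) \<in> parts N l" "\<forall>r. s \<noteq> BB r" for p q s
    using that by (cases s) (auto simp: f mem_parts_iff Cdiff_simps)
  have g_mem: "g (p + a + int r + 1, q - a - int r, ZZ r) \<in>
      carrier (part_space a X N (p + a + int r + 1, q - a - int r, ZZ r))"
    if "(p, q, BB r) \<in> parts N l" for p q r
  proof -
    have "(p + a + int r + 1, q - a - int r, ZZ r) \<in> parts N (l + 1)"
      using that by (auto simp: mem_parts_iff)
    then show ?thesis using g unfolding Cplx_def mem_dsum_iff by blast
  qed
  have f_BB: "f (p, q, BB r) = dbar a X r (p + a + int r + 1) (q - a - int r)
      (g (p + a + int r + 1, q - a - int r, ZZ r))" if "(p, q, BB r) \<in> parts N l" for p q r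
    using that by (simp add: f mem_parts_iff Cdiff_simps(1))
  have "f i \<in> carrier (part_space a X N i)" if i: "i \<in> parts N l" for i
  proof -
    obtain p q s where pqs: "i = (p, q, s)" by (cases i)
    show ?thesis
    proof (cases "\<exists>r. s = BB r")
      case True
      then obtain r where r: "s = BB r" by blast
      with i pqs have "(p, q, BB r) \<in> parts N l" by simp
      then show ?thesis unfolding pqs r using dbar_part_space(2)[OF g_mem] f_BB by simp
    next
      case False
      then show ?thesis using f_zero i zero_part_space unfolding pqs by metis
    qed
  qed
  moreover have "finite {i \<in> parts N l. f i \<noteq> \<zero>\<^bsub>part_space a X N i\<^esub>}"
  proof (rule finite_surj)
    \<comment> \<open>Sends the index that \<open>Cdiff\<close> reads to the index that it writes.
      Its unspecified values on other indices are harmless: only an inclusion into a finite image is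
      claimed.\<close>
    let ?h = "\<lambda>(p, q, s). case s of ZZ r \<Rightarrow> (p - a - int r - 1, q + a + int r, BB r)"
    show "finite {i \<in> parts N (l + 1). g i \<noteq> \<zero>\<^bsub>part_space a X N i\<^esub>}"
      using g by (simp add: Cplx_def mem_dsum_iff)
    show "{i \<in> parts N l. f i \<noteq> \<zero>\<^bsub>part_space a X N i\<^esub>} \<subseteq> ?h ` {i \<in> parts N (l + 1). g i \<noteq> \<zero>\<^bsub>part_space a X N i\<^esub>}"
    proof clarify
      fix p q s assume i: "(p, q, s) \<in> parts N l" and "f (p, q, s) \<noteq> \<zero>\<^bsub>part_space a X N (p, q, s)\<^esub>"
      then obtain r where r: "s = BB r" using f_zero by blast
      let ?i = "(p + a + int r + 1, q - a - int r, ZZ r)"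
      have "g ?i \<noteq> \<zero>\<^bsub>part_space a X N ?i\<^esub>"
        using \<open>f (p, q, s) \<noteq> _\<close> f_BB[of p q r] i dbar_part_space(1)[of r p q N] unfolding r by metis
      moreover have "?i \<in> parts N (l + 1)" using i by (auto simp: r mem_parts_iff)
      ultimately have "?i \<in> {i \<in> parts N (l + 1). g i \<noteq> \<zero>\<^bsub>part_space a X N i\<^esub>}" by blast
      moreover have "(p, q, s) = ?h ?i" by (simp add: r)
      ultimately show "(p, q, s) \<in> ?h ` {i \<in> parts N (l + 1). g i \<noteq> \<zero>\<^bsub>part_space a X N i\<^esub>}"
        by (rule image_eqI[rotated])
    qed
  qed
  moreover have "f \<in> extensional (parts N l)"
    using Cdiff_simps(4)[of a X N "l + 1" g] by (simp add: f)
  ultimately show "f \<in> ?R"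
    using f_zero by (auto simp: Cplx_def mem_dsum_iff)
next
  fix f assume "f \<in> ?R"
  then have f: "f \<in> carrier (Cplx a X N l)"
    and f_zero: "\<And>p q s. (p, q, s) \<in> parts N l \<Longrightarrow> \<forall>r. s \<noteq> BB r \<Longrightarrow> f (p, q, s) = \<zero>\<^bsub>part_space a X N (p, q, s)\<^esub>"
    by blast+
  have f_mem: "f i \<in> carrier (part_space a X N i)" if "i \<in> parts N l" for i
    using f that by (auto simp: Cplx_def mem_dsum_iff)
  \<comment> \<open>The last clause, a consequence of injectivity, keeps the support of the lifted
    family finite.\<close>
  have "\<exists>c\<in>carrier (part_space a X N (p + a + int r + 1, q - a - int r, ZZ r)).
      dbar a X r (p + a + int r + 1) (q - a - int r) c = f (p, q, BB r) \<and>
      (f (p, q, BB r) = \<zero>\<^bsub>part_space a X N (p, q, BB r)\<^esub> \<longrightarrow> c = \<zero>\<^bsub>part_space a X N (p + a + int r + 1, q - a - int r, ZZ r)\<^esub>)"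
    if "(p, q, BB r) \<in> parts N l" for p q r
    using dbar_part_space(4)[OF f_mem[OF that]] dbar_part_space(3) by metis
  then obtain c where c: "\<And>p q r. (p, q, BB r) \<in> parts N l \<Longrightarrow> c p q r \<in> carrier (part_space a X N (p + a + int r + 1, q - a - int r, ZZ r))"
    "\<And>p q r. (p, q, BB r) \<in> parts N l \<Longrightarrow> dbar a X r (p + a + int r + 1) (q - a - int r) (c p q r) = f (p, q, BB r)"
    "\<And>p q r. (p, q, BB r) \<in> parts N l \<Longrightarrow> f (p, q, BB r) = \<zero>\<^bsub>part_space a X N (p, q, BB r)\<^esub> \<Longrightarrow>
       c p q r = \<zero>\<^bsub>part_space a X N (p + a + int r + 1, q - a - int r, ZZ r)\<^esub>"
    by metis
  define g where "g = (\<lambda>(p, q, s)\<in>parts N (l + 1). case s of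
      ZZ r \<Rightarrow> c (p - a - int r - 1) (q + a + int r) r | _ \<Rightarrow> \<zero>\<^bsub>part_space a X N (p, q, s)\<^esub>)"
  have g_ZZ: "g (p + a + int r + 1, q - a - int r, ZZ r) = c p q r" if "(p, q, BB r) \<in> parts N l" for p q r
    using that by (auto simp: g_def mem_parts_iff)
  have g_zero: "g (p, q, s) = \<zero>\<^bsub>part_space a X N (p, q, s)\<^esub>"
    if "(p, q, s) \<in> parts N (l + 1)" "\<forall>r. s \<noteq> ZZ r" for p q s
    using that by (cases s) (auto simp: g_def)
  have ZZ_cases: "\<exists>p' q'. (p', q', BB r) \<in> parts N l \<and> p = p' + a + int r + 1 \<and> q = q' - a - int r"
    if "(p, q, ZZ r) \<in> parts N (l + 1)" for p q r
    using that by (intro exI[of _ "p - a - int r - 1"] exI[of _ "q + a + int r"]) (auto simp: mem_parts_iff)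
  have "g i \<in> carrier (part_space a X N i)" if i: "i \<in> parts N (l + 1)" for i
  proof -
    obtain p q s where pqs: "i = (p, q, s)" by (cases i)
    show ?thesis
    proof (cases "\<exists>r. s = ZZ r")
      case True
      then obtain r where r: "s = ZZ r" by blast
      with i pqs obtain p' q' where "(p', q', BB r) \<in> parts N l" "p = p' + a + int r + 1" "q = q' - a - int r"
        using ZZ_cases by blast
      then show ?thesis unfolding pqs r using g_ZZ c(1) by metis
    next
      case False
      then show ?thesis using g_zero i zero_part_space unfolding pqs by metis
    qed
  qed
  moreover have "finite {i \<in> parts N (l + 1). g i \<noteq> \<zero>\<^bsub>part_space a X N i\<^esub>}"
  proof (rule finite_surj)
    let ?h = "\<lambda>(p, q, s). case s of BB r \<Rightarrow> (p + a + int r + 1, q - a - int r, ZZ r)"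
    show "finite {i \<in> parts N l. f i \<noteq> \<zero>\<^bsub>part_space a X N i\<^esub>}"
      using f by (simp add: Cplx_def mem_dsum_iff)
    show "{i \<in> parts N (l + 1). g i \<noteq> \<zero>\<^bsub>part_space a X N i\<^esub>} \<subseteq> ?h ` {i \<in> parts N l. f i \<noteq> \<zero>\<^bsub>part_space a X N i\<^esub>}"
    proof clarify
      fix p q s assume i: "(p, q, s) \<in> parts N (l + 1)" and ne: "g (p, q, s) \<noteq> \<zero>\<^bsub>part_space a X N (p, q, s)\<^esub>"
      then obtain r where r: "s = ZZ r" using g_zero by blast
      then obtain p' q' where *: "(p', q', BB r) \<in> parts N l" "p = p' + a + int r + 1" "q = q' - a - int r"
        using ZZ_cases i by blast
      then have "f (p', q', BB r) \<noteq> \<zero>\<^bsub>part_space a X N (p', q', BB r)\<^esub>"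
        using ne g_ZZ[OF *(1)] c(3)[OF *(1)] unfolding r by metis
      with * have "(p', q', BB r) \<in> {i \<in> parts N l. f i \<noteq> \<zero>\<^bsub>part_space a X N i\<^esub>}" by blast
      moreover have "(p, q, s) = ?h (p', q', BB r)" by (simp add: r *)
      ultimately show "(p, q, s) \<in> ?h ` {i \<in> parts N l. f i \<noteq> \<zero>\<^bsub>part_space a X N i\<^esub>}"
        by (rule image_eqI[rotated])
    qed
  qed
  ultimately have g: "g \<in> carrier (Cplx a X N (l + 1))"
    by (auto simp: Cplx_def mem_dsum_iff g_def)
  have "f = Cdiff a X N (l + 1) g"
  proof (rule extensionalityI[of _ "parts N l"])
    show "f \<in> extensional (parts N l)" using f by (simp add: Cplx_def mem_dsum_iff)
    show "Cdiff a X N (l + 1) g \<in> extensional (parts N l)"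
      using Cdiff_simps(4)[of a X N "l + 1" g] by simp
    fix i assume i: "i \<in> parts N l"
    obtain p q s where pqs: "i = (p, q, s)" by (cases i)
    show "f i = Cdiff a X N (l + 1) g i"
    proof (cases "\<exists>r. s = BB r")
      case True
      then obtain r where r: "s = BB r" by blast
      with i pqs have mem: "(p, q, BB r) \<in> parts N l" by simp
      then have "p + q = l + 1 - 1" "r < N" by (auto simp: mem_parts_iff)
      then show ?thesis unfolding pqs r by (simp only: Cdiff_simps(1) g_ZZ[OF mem] c(2)[OF mem])
    next
      case False
      then have "f i = \<zero>\<^bsub>part_space a X N i\<^esub>" using f_zero i unfolding pqs by blast
      then show ?thesis using False i unfolding pqs
        by (cases s) (auto simp: mem_parts_iff Cdiff_simps(2,3))
    qed
  qed
  with g show "f \<in> Cdiff a X N (l + 1) ` carrier (Cplx a X N (l + 1))" by blast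
qed

end

text \<open>The first isomorphism theorem for the projection of cycles to the \<open>ZB\<close>
  coordinates with \<open>s < p \<le> t\<close>; in degree l such a coordinate is determined by p.
  The half-open range matches the graded pieces of F that can be nonzero.\<close>

lemma (in exact_couple) vs_iso_homology_Cplx:
  fixes V :: "('k, 'h) module" and F :: "int \<Rightarrow> 'h set"
  assumes V: "vectorspace K V" and F: "\<And>p. subspace K (F p) V" "\<And>p. F (p - 1) \<subseteq> F p"
    and lower: "\<And>p. p \<le> s \<Longrightarrow> F p = {\<zero>\<^bsub>V\<^esub>}" and upper: "\<And>p. t \<le> p \<Longrightarrow> F p = carrier V" and "s \<le> t"
    and iso: "\<And>p. vs_iso K (page a X N p (l - p)) (subquot V (F p) (F (p - 1)))"
  shows "vs_iso K (homology_space (Cplx a X N) (Cdiff a X N) l) V"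
proof -
  have page: "part_space a X N (p, q, ZB) = page a X N p q" for p q
    by (simp add: page_def)
  \<comment> \<open>The \<open>ZB\<close> summand is to be rewritten to \<open>page\<close> and not
    unfolded to \<open>subquot\<close>.\<close>
  note part_space.simps [simp del]
  define C where "C = Cplx a X N l"
  define S where "S = dsum {s<..t} (\<lambda>p. page a X N p (l - p))"
  define Z where "Z = ker_of C (Cplx a X N (l - 1)) (Cdiff a X N l)"
  define B where "B = Cdiff a X N (l + 1) ` carrier (Cplx a X N (l + 1))"
  define \<pi> where "\<pi> f = (\<lambda>p\<in>{s<..t}. f (p, l - p, ZB))" for f :: "int \<times> int \<times> part \<Rightarrow> 'e set"
  note Z_eq = ker_Cdiff[of N l, folded C_def, folded Z_def] and B_eq = im_Cdiff[of N l, folded C_def, folded B_def]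
  have page_vs: "vectorspace K (page a X N p q)" for p q
    using vectorspace_part_space[of N "(p, q, ZB)"] unfolding page .
  \<comment> \<open>Outside the range either p and p - 1 are both at most s, or p > t and hence p -
    1 is still at least t. Either way F p = F (p - 1), the graded piece is one point, and so is the
    page.\<close>
  have page_trivial: "f = \<zero>\<^bsub>part_space a X N (p, l - p, ZB)\<^esub>"
    if f: "f \<in> carrier (part_space a X N (p, l - p, ZB))" and p: "p \<notin> {s<..t}" for f p
  proof -
    have "F p = F (p - 1)"
    proof (cases "p \<le> s")
      case True
      then show ?thesis using lower[of p] lower[of "p - 1"] by simp
    next
      case False
      then show ?thesis using p upper[of p] upper[of "p - 1"] by simp
    qed
    then have "carrier (subquot V (F p) (F (p - 1))) = {F p}"
      using carrier_subquot_self[OF F(1)] by metis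
    moreover obtain T where "bij_betw T (carrier (page a X N p (l - p))) (carrier (subquot V (F p) (F (p - 1))))"
      using iso[of p] by (auto simp: vs_iso_def)
    ultimately have "inj_on T (carrier (page a X N p (l - p)))" "T ` carrier (page a X N p (l - p)) = {F p}"
      by (simp_all add: bij_betw_def)
    then show ?thesis
      using f zero_part_space[of N "(p, l - p, ZB)"] unfolding page
      by (metis imageI inj_onD singletonD)
  qed
  have mem: "(p, l - p, ZB) \<in> parts N l" for p by (simp add: mem_parts_iff)
  have C_vs: "vectorspace K C" unfolding C_def by (rule vectorspace_Cplx)
  have Z_sub: "subspace K Z C"
    unfolding Z_eq unfolding C_def Cplx_def
    by (rule dsum_vanishing_subspace[OF field_K vectorspace_part_space]) blast
  have CD: "f i \<in> carrier (part_space a X N i)" if "f \<in> carrier C" "i \<in> parts N l" for f i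
    using that unfolding C_def Cplx_def mem_dsum_iff by blast
  have "linear_map K C S \<pi>"
  proof (rule linear_mapI[OF C_vs])
    show "vectorspace K S" unfolding S_def by (rule vectorspace_dsum[OF field_K page_vs])
    show "\<pi> f \<in> carrier S" if "f \<in> carrier C" for f
      using CD[OF that mem] unfolding S_def mem_dsum_iff page
      by (intro conjI ballI finite_Collect_conjI disjI1) (auto simp: \<pi>_def)
  qed (auto simp: \<pi>_def S_def C_def Cplx_def dsum_ops fun_eq_iff mem page)
  then have lin: "linear_map K (C\<lparr>carrier := Z\<rparr>) S \<pi>"
    by (rule linear_map_restrict) (rule Z_sub)
  have surj: "\<pi> ` carrier (C\<lparr>carrier := Z\<rparr>) = carrier S"
  proof (intro equalityI subsetI)
    fix e assume "e \<in> \<pi> ` carrier (C\<lparr>carrier := Z\<rparr>)"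
    then show "e \<in> carrier S"
      using mod_hom.f_im[OF linear_map.axioms(3)[OF lin]] by blast
  next
    fix e assume e: "e \<in> carrier S"
    \<comment> \<open>Extension of e by zero; it is a cycle because its \<open>ZZ\<close>
      coordinates vanish.\<close>
    define f where "f = (\<lambda>(p, q, u)\<in>parts N l. if u = ZB \<and> p \<in> {s<..t} then e p else \<zero>\<^bsub>part_space a X N (p, q, u)\<^esub>)"
    have f_ZB: "f (p, l - p, ZB) = e p" if "p \<in> {s<..t}" for p
      using that mem by (simp add: f_def)
    have f_zero: "f i = \<zero>\<^bsub>part_space a X N i\<^esub>"
      if "i \<in> parts N l" "i \<notin> (\<lambda>p. (p, l - p, ZB)) ` {s<..t}" for i
      using that by (cases i) (auto simp: f_def mem_parts_iff image_iff)
    have "f i \<in> carrier (part_space a X N i)" if "i \<in> parts N l" for i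
    proof (cases "i \<in> (\<lambda>p. (p, l - p, ZB)) ` {s<..t}")
      case True
      then obtain p where "p \<in> {s<..t}" "i = (p, l - p, ZB)" by blast
      then show ?thesis using e f_ZB unfolding S_def mem_dsum_iff by (simp add: page)
    next
      case False
      then show ?thesis using f_zero[OF that] zero_part_space by simp
    qed
    moreover have "finite {i \<in> parts N l. f i \<noteq> \<zero>\<^bsub>part_space a X N i\<^esub>}"
      by (rule finite_subset[of _ "(\<lambda>p. (p, l - p, ZB)) ` {s<..t}"]) (use f_zero in blast, simp)
    moreover have "f \<in> extensional (parts N l)" by (simp add: f_def)
    ultimately have "f \<in> carrier C" unfolding C_def Cplx_def mem_dsum_iff by blast
    then have "f \<in> Z" unfolding Z_eq using f_zero by blast
    moreover have "\<pi> f = e"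
      using e f_ZB by (intro extensionalityI[of _ "{s<..t}"]) (auto simp: \<pi>_def S_def mem_dsum_iff)
    ultimately show "e \<in> \<pi> ` carrier (C\<lparr>carrier := Z\<rparr>)" by auto
  qed
  have "ker_of (C\<lparr>carrier := Z\<rparr>) S \<pi> = B"
  proof (intro equalityI subsetI)
    fix f assume "f \<in> ker_of (C\<lparr>carrier := Z\<rparr>) S \<pi>"
    then have f: "f \<in> Z" and 0: "\<pi> f = \<zero>\<^bsub>S\<^esub>" by (auto simp: ker_of_def)
    then have fC: "f \<in> carrier C" by (simp add: Z_def ker_of_def)
    \<comment> \<open>Of the coordinates outside \<open>BB\<close>, the \<open>ZZ\<close> ones
      vanish on cycles, and the \<open>ZB\<close> ones vanish by the assumption on the projection
      within the range and by \<open>page_trivial\<close> beyond it. What is left is a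
      boundary.\<close>
    have "f (p, q, u) = \<zero>\<^bsub>part_space a X N (p, q, u)\<^esub>" if pqu: "(p, q, u) \<in> parts N l" and "\<forall>r. u \<noteq> BB r" for p q u
    proof (cases u)
      case ZB
      then have q: "q = l - p" using pqu by (auto simp: mem_parts_iff)
      show ?thesis
      proof (cases "p \<in> {s<..t}")
        case True
        then show ?thesis using fun_cong[OF 0, of p] by (simp add: \<pi>_def S_def dsum_ops ZB q page)
      next
        case False
        then show ?thesis unfolding ZB q by (rule page_trivial[OF CD[OF fC mem]])
      qed
    next
      case (ZZ r)
      then show ?thesis using f pqu unfolding Z_eq by blast
    qed (use that in auto)
    with fC show "f \<in> B" unfolding B_eq by blast
  next
    fix f assume "f \<in> B"
    then have fC: "f \<in> carrier C"
      and 0: "\<And>p q u. (p, q, u) \<in> parts N l \<Longrightarrow> \<forall>r. u \<noteq> BB r \<Longrightarrow> f (p, q, u) = \<zero>\<^bsub>part_space a X N (p, q, u)\<^esub>"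
      unfolding B_eq by blast+
    have "f \<in> Z" unfolding Z_eq using fC 0 by blast
    moreover have "\<pi> f = \<zero>\<^bsub>S\<^esub>"
      unfolding \<pi>_def S_def dsum_ops by (intro restrict_ext) (simp add: 0 mem page)
    ultimately show "f \<in> ker_of (C\<lparr>carrier := Z\<rparr>) S \<pi>" by (simp add: ker_of_def)
  qed
  then have "homology_space (Cplx a X N) (Cdiff a X N) l = quot_space (C\<lparr>carrier := Z\<rparr>) (ker_of (C\<lparr>carrier := Z\<rparr>) S \<pi>)"
    by (simp add: homology_space_def subquot_def flip: C_def Z_def B_def)
  also have "vs_iso K \<dots> S" by (rule vs_iso_quot_ker[OF lin surj])
  also have "vs_iso K S (V\<lparr>carrier := F t\<rparr>)"
    unfolding S_def using V F lower[of s] iso \<open>s \<le> t\<close> by (intro vs_iso_filtration) auto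
  also have "V\<lparr>carrier := F t\<rparr> = V" using upper[of t] by simp
  finally show ?thesis .
qed

theorem proposition2p14:
  fixes K :: "'k ring" and a :: int and X :: "('k, 'd, 'e) couple"
    and H :: "int \<Rightarrow> ('k, 'h) module" and N :: nat
  assumes "field K"
    and "exact_couple K a X"
    and "finite_total_dim K X"
    and "stable_from a X N"
    and "\<And>l. vectorspace K (H l)"
    and "converges_to K a X H"
  shows "\<forall>l. vs_iso K (homology_space (Cplx a X N) (Cdiff a X N) l) (H l)"
proof
  fix l
  interpret exact_couple K a X by fact
  \<comment> \<open>The bounds and the filtration may depend on the degree, so they are chosen after
    l is fixed.\<close>
  obtain s t F where st: "s \<le> t"
    and F: "\<forall>p. subspace K (F p) (H l)" "\<forall>p. F (p - 1) \<subseteq> F p"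
      "\<forall>p\<le>s. F p = {\<zero>\<^bsub>H l\<^esub>}" "\<forall>p\<ge>t. F p = carrier (H l)"
    and iso: "\<forall>p q. p + q = l \<longrightarrow> vs_iso K (E_infty a X p q) (subquot (H l) (F p) (F (p - 1)))"
    using spec[OF assms(6)[unfolded converges_to_def], of l] by (elim exE conjE)
  show "vs_iso K (homology_space (Cplx a X N) (Cdiff a X N) l) (H l)"
  proof (rule vs_iso_homology_Cplx[where F = F, OF assms(5) _ _ _ _ st])
    fix p
    show "vs_iso K (page a X N p (l - p)) (subquot (H l) (F p) (F (p - 1)))"
      using iso[rule_format, of p "l - p"] unfolding E_infty_stable[OF assms(4)] by simp
  qed (use F in auto)
qed

end
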